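(* Let $p\ge 2$ and suppose $z(t)\in L^p(\Omega,\mathbb P)$ for every $t\in[0,T]$ and $\int_0^T \mathbb E[|z(t)|^p]^{2/p}\,dt<+\infty$. Let $F:[0,T]\times\mathbb R\to\mathbb R$ satisfy: (i) $F(t,\xi)\ge 0$ for all $(t,\xi)$; (ii) $F(t,\xi)$ is twice continuously differentiable in $\xi$ and $\frac{\partial F}{\partial \xi}$, $\frac{\partial^2 F}{\partial \xi^2}$ are continuous functions of both variables; (iii) there exist $\alpha\in(0,p)$ and a non-negative $L\in L^1(0,T)$ such that $|F(t,\xi)|+\left|\frac{\partial F}{\partial \xi}(t,\xi)\right|+\left|\frac{\partial^2 F}{\partial \xi^2}(t,\xi)\right|\le L(t)(1+|\xi|^\alpha)$ for all $t\in[0,T]$, $\xi\in\mathbb R$. Let $\overline u\in L^1(0,T)$ be a global minimum of $J$ over $L^1(0,T)$. Then $$\int_{t_0}^T \mathbb E\left[\frac{\partial F}{\partial \xi}(t,\xi_{\overline u}(t))\,\frac{G(t)}{G(t_0)}\,e^{A(t)-A(t_0)}\right]dt=0\qquad\text{for all } t_0\in[0,T].$$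
   Context: Fix $T>0$, a filtered probability space $(\Omega,\mathcal F,(\mathcal F_t)_{t\ge 0},\mathbb P)$ and an $\mathcal F_t$-Brownian motion $W$ (started at $0$). $a:[0,T]\to\mathbb R$ is a deterministic function in $L^\infty(0,T)$, $A(t)=\int_0^t a(s)\,ds$, $G(t)=e^{W(t)-t/2}$. $z$ is a real $\mathcal F_t$-adapted, jointly measurable process; $F$ is Borel measurable. $L^1(0,T)$ denotes deterministic integrable real functions. For $u\in L^1(0,T)$ put $$\xi_u(t)=G(t)e^{A(t)}\int_0^t\frac{e^{-A(s)}}{G(s)}(z(s)-u(s))\,ds,$$ i.e. the solution of $d\xi=[a(t)\xi+z(t)-u(t)]dt+\xi\,dW(t)$, $\xi(0)=0$, and define $J[u]=\mathbb E\left[\int_0^T F(t,\xi_u(t))\,dt\right]$. *)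

theory Defs
  imports "HOL-Probability.Probability"
begin

text \<open>
  Time is the real half-line: processes and filtrations have type \<open>real \<Rightarrow> _\<close>, and only their
  values at times \<open>t \<ge> 0\<close> are constrained or used.  The library locale \<open>filtration\<close> would also
  demand sigma-algebras at negative times.
\<close>

definition filtered_prob_space :: "'a measure \<Rightarrow> (real \<Rightarrow> 'a measure) \<Rightarrow> bool" where
  "filtered_prob_space M Fl \<longleftrightarrow>
     prob_space M \<and>
     (\<forall>t\<ge>0. subalgebra M (Fl t)) \<and>
     (\<forall>s t. 0 \<le> s \<and> s \<le> t \<longrightarrow> sets (Fl s) \<subseteq> sets (Fl t))"

text \<open>
  Standard Brownian motion relative to the filtration \<open>Fl\<close>, started at \<open>0\<close>.  All paths are
  required to be continuous; no completeness of \<open>M\<close> or of the filtration is assumed.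
  The second argument of \<open>normal_density\<close> is the standard deviation.
\<close>

definition brownian_motion ::
    "'a measure \<Rightarrow> (real \<Rightarrow> 'a measure) \<Rightarrow> (real \<Rightarrow> 'a \<Rightarrow> real) \<Rightarrow> bool" where
  "brownian_motion M Fl W \<longleftrightarrow>
     (\<forall>t\<ge>0. W t \<in> borel_measurable (Fl t)) \<and>
     (AE \<omega> in M. W 0 \<omega> = 0) \<and>
     (\<forall>\<omega>\<in>space M. continuous_on {0..} (\<lambda>t. W t \<omega>)) \<and>
     (\<forall>s t. 0 \<le> s \<and> s < t \<longrightarrow>
        distributed M lborel (\<lambda>\<omega>. W t \<omega> - W s \<omega>) (normal_density 0 (sqrt (t - s))) \<and>
        prob_space.indep_set M (sets (Fl s))
          {(\<lambda>\<omega>. W t \<omega> - W s \<omega>) -` B \<inter> space M | B. B \<in> sets borel})"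

definition primitive :: "(real \<Rightarrow> real) \<Rightarrow> real \<Rightarrow> real" where
  "primitive a t = (LINT s:{0..t}|lebesgue. a s)"

definition geom_bm :: "(real \<Rightarrow> 'a \<Rightarrow> real) \<Rightarrow> real \<Rightarrow> 'a \<Rightarrow> real" where
  "geom_bm W t \<omega> = exp (W t \<omega> - t / 2)"

definition state ::
    "(real \<Rightarrow> 'a \<Rightarrow> real) \<Rightarrow> (real \<Rightarrow> real) \<Rightarrow> (real \<Rightarrow> 'a \<Rightarrow> real) \<Rightarrow> (real \<Rightarrow> real) \<Rightarrow> real \<Rightarrow> 'a \<Rightarrow> real"
  where
  "state W a z u t \<omega> =
     geom_bm W t \<omega> * exp (primitive a t) *
     (LINT s:{0..t}|lebesgue. exp (- primitive a s) / geom_bm W s \<omega> * (z s \<omega> - u s))"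

text \<open>
  The cost takes values in \<open>[0, \<infinity>]\<close>.  It is meant for \<open>F \<ge> 0\<close> on \<open>[0, T] \<times> \<real>\<close>, where the
  coercion \<open>ennreal\<close> is faithful (it would cut off negative values).
\<close>

definition cost ::
    "'a measure \<Rightarrow> (real \<Rightarrow> 'a \<Rightarrow> real) \<Rightarrow> (real \<Rightarrow> real) \<Rightarrow> (real \<Rightarrow> 'a \<Rightarrow> real) \<Rightarrow>
     (real \<Rightarrow> real \<Rightarrow> real) \<Rightarrow> real \<Rightarrow> (real \<Rightarrow> real) \<Rightarrow> ennreal" where
  "cost M W a z F T u =
     (\<integral>\<^sup>+ \<omega>. (\<integral>\<^sup>+ t\<in>{0..T}. ennreal (F t (state W a z u t \<omega>)) \<partial>lebesgue) \<partial>M)"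

end

theory Submission
  imports Defs
begin

text \<open>
  Write \<open>E t = geom_bm W t * exp (primitive a t)\<close>.  The state depends affinely on the control:
  replacing \<open>u\<close> by \<open>u + \<epsilon> v\<close> replaces \<open>\<xi>\<close> by \<open>\<xi> - \<epsilon> \<eta>\<close>, where \<open>\<eta> t\<close> is the integral of
  \<open>v s * E t / E s\<close> over \<open>s \<le> t\<close>.  At a minimum, Fermat's rule for \<open>\<epsilon> \<mapsto> J[u + \<epsilon> v]\<close> says that
  the expected time integral of \<open>F\<^sub>1 t (\<xi> t) * \<eta> t\<close> vanishes (\<open>first_variation\<close>).  If \<open>v\<close> runs through
  unit masses concentrated on ever shorter intervals just after \<open>t\<^sub>0\<close>, then \<open>\<eta> t\<close> tends to
  \<open>E t / E t\<^sub>0\<close> for \<open>t > t\<^sub>0\<close> and is \<open>0\<close> before, which gives the claim for every single \<open>t\<^sub>0\<close>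
  (\<open>adjoint_vanishes\<close>), not merely for almost every one.

  Both limits are dominated convergence on the product of time and probability space, so everything
  rests on one integrable majorant.  Almost all paths of \<open>E\<close> and \<open>1 / E\<close> are bounded on \<open>[0, T]\<close> by a
  random variable \<open>S \<ge> 1\<close> that does not depend on time.  Hence \<open>\<bar>\<eta>\<bar> \<le> S\<^sup>2\<close> for all \<open>v\<close> of mass at most
  \<open>1\<close>, and \<open>\<bar>\<xi>\<bar> + \<bar>\<eta>\<bar> \<le> S\<^sup>2 \<zeta>\<close>, where \<open>\<zeta>\<close> is a constant plus the time integral of \<open>\<bar>z\<bar>\<close>.  By the
  growth condition, every integrand that occurs has absolute value at most
  \<open>L t * 2 S\<^bsup>2+2\<alpha>\<^esup> \<zeta>\<^sup>\<alpha>\<close>: a function of time alone times a random variable.  The random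
  factor is integrable because \<open>\<alpha> < p\<close>: the \<open>p\<close>-th moment of \<open>\<zeta>\<close> is finite by a form of
  Minkowski's integral inequality (\<open>integral_moment_finite\<close>), a sufficiently high moment of \<open>S\<close> is
  finite by a maximal inequality for exponentials of Brownian motion (\<open>exp_abs_sup_integrable\<close>), and
  \<open>integrable_powr_mult_powr\<close> combines the two.
\<close>

section \<open>Exponential moments of the maximum of Brownian motion\<close>

text \<open>
  The pathwise form of Doob's \<open>L\<^sup>2\<close> maximal inequality.  The running maximum \<open>m\<close> grows only at steps
  where it equals the new value, so Abel summation bounds \<open>(m n)\<^sup>2 / 2\<close> by \<open>m n * x n\<close> minus the
  discrete stochastic integral of \<open>m\<close> against \<open>x\<close>.  For a submartingale \<open>x\<close> this integral has
  nonnegative expectation, and \<open>(m n)\<^sup>2\<close> has at most four times the expectation of \<open>(x n)\<^sup>2\<close>.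
\<close>

lemma maximal_square_le:
  fixes x :: "nat \<Rightarrow> real"
  assumes nonneg: "\<And>i. 0 \<le> x i"
  defines "m \<equiv> \<lambda>n. Max (x ` {..n})"
  shows "(m n)\<^sup>2 + 4 * (\<Sum>i<n. m i * (x (Suc i) - x i)) \<le> 4 * (x n)\<^sup>2"
proof -
  have "(m n)\<^sup>2 / 2 \<le> m n * x n - (\<Sum>i<n. m i * (x (Suc i) - x i))"
  proof (induction n)
    case 0
    then show ?case by (simp add: m_def power2_eq_square)
  next
    case (Suc n)
    have "m (Suc n) = max (x (Suc n)) (m n)"
      by (simp add: m_def atMost_Suc)
    then have "(m (Suc n))\<^sup>2 - (m n)\<^sup>2 \<le> 2 * ((m (Suc n) - m n) * x (Suc n))"
      using mult_nonneg_nonneg[of "m (Suc n) - m n" "m (Suc n) - m n"]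
      by (auto simp: power2_eq_square max_def algebra_simps)
    with Suc show ?case
      by (simp add: algebra_simps)
  qed
  moreover have "4 * (m n * x n) \<le> (m n)\<^sup>2 + 4 * (x n)\<^sup>2"
    using zero_le_power2[of "m n - 2 * x n"] by (simp add: power2_eq_square algebra_simps)
  ultimately show ?thesis
    by (simp add: field_simps)
qed

text \<open>
  Completing the square turns the exponentially tilted centred normal density into a multiple of the
  normal density with mean \<open>k \<sigma>\<^sup>2\<close>.
\<close>

lemma (in prob_space) normal_exponential_moment:
  assumes X: "distributed M lborel X (normal_density 0 \<sigma>)" and \<sigma>: "0 < \<sigma>"
  shows "integrable M (\<lambda>\<omega>. exp (k * X \<omega>))"
    and "expectation (\<lambda>\<omega>. exp (k * X \<omega>)) = exp (k\<^sup>2 * \<sigma>\<^sup>2 / 2)"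
proof -
  have *: "normal_density 0 \<sigma> x * exp (k * x) = exp (k\<^sup>2 * \<sigma>\<^sup>2 / 2) * normal_density (k * \<sigma>\<^sup>2) \<sigma> x" for x
  proof -
    have "- (x\<^sup>2 / (2 * \<sigma>\<^sup>2)) + k * x = k\<^sup>2 * \<sigma>\<^sup>2 / 2 + - ((x - k * \<sigma>\<^sup>2)\<^sup>2 / (2 * \<sigma>\<^sup>2))"
      using \<sigma> by (simp add: field_simps power2_eq_square)
    then show ?thesis
      by (simp add: normal_density_def flip: exp_add)
  qed
  have "integrable lborel (\<lambda>x. normal_density 0 \<sigma> x * exp (k * x))"
    unfolding * using \<sigma> by simp
  then show "integrable M (\<lambda>\<omega>. exp (k * X \<omega>))"
    using distributed_integrable[OF X, of "\<lambda>x. exp (k * x)"] by simp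
  show "expectation (\<lambda>\<omega>. exp (k * X \<omega>)) = exp (k\<^sup>2 * \<sigma>\<^sup>2 / 2)"
    using distributed_integral[OF X, of "\<lambda>x. exp (k * x)"] \<sigma> by (simp add: *)
qed

lemma grid_floor_tendsto:
  fixes t c :: real
  assumes t: "0 \<le> t" and c: "0 < c"
  shows "(\<lambda>n. real (nat \<lfloor>t * real (Suc n) / c\<rfloor>) * (c / real (Suc n))) \<longlonglongrightarrow> t"
proof -
  define s where "s n = real (nat \<lfloor>t * real (Suc n) / c\<rfloor>) * (c / real (Suc n))" for n
  have "t - c / real (Suc n) \<le> s n" "s n \<le> t" for n
  proof -
    let ?i = "real (nat \<lfloor>t * real (Suc n) / c\<rfloor>)"
    have "0 \<le> t * real (Suc n) / c" using t c by simp
    then have fl: "?i \<le> t * real (Suc n) / c" "t * real (Suc n) / c \<le> ?i + 1"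
      by linarith+
    have eq: "t * real (Suc n) / c * (c / real (Suc n)) = t" using c by simp
    show "s n \<le> t"
      using mult_right_mono[OF fl(1), of "c / real (Suc n)"] c unfolding eq s_def by simp
    have "t \<le> (?i + 1) * (c / real (Suc n))"
      using mult_right_mono[OF fl(2), of "c / real (Suc n)"] c unfolding eq by simp
    then show "t - c / real (Suc n) \<le> s n"
      unfolding s_def distrib_right by simp
  qed
  moreover have "(\<lambda>n. t - c / real (Suc n)) \<longlonglongrightarrow> t - 0"
    by (intro tendsto_diff tendsto_const LIMSEQ_Suc lim_const_over_n)
  ultimately have "s \<longlonglongrightarrow> t"
    by (intro tendsto_sandwich[of "\<lambda>n. t - c / real (Suc n)" s _ "\<lambda>_. t"]) auto
  then show ?thesis by (simp only: s_def[abs_def])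
qed

locale brownian = prob_space M
  for M :: "'a measure" and Fl :: "real \<Rightarrow> 'a measure" and W :: "real \<Rightarrow> 'a \<Rightarrow> real" +
  assumes filtered: "filtered_prob_space M Fl" and brownian: "brownian_motion M Fl W"
begin

lemmas bm = brownian[unfolded brownian_motion_def]
lemmas bm_adapted = bm[THEN conjunct1, rule_format]
  and bm_start = bm[THEN conjunct2, THEN conjunct1]
  and bm_continuous = bm[THEN conjunct2, THEN conjunct2, THEN conjunct1, rule_format]
  and bm_increment = bm[THEN conjunct2, THEN conjunct2, THEN conjunct2, rule_format]

lemmas fp = filtered[unfolded filtered_prob_space_def]
lemmas subalgebra_Fl = fp[THEN conjunct2, THEN conjunct1, rule_format]
  and fp_mono = fp[THEN conjunct2, THEN conjunct2, rule_format]

lemma space_Fl: "0 \<le> t \<Longrightarrow> space (Fl t) = space M"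
  using subalgebra_Fl[of t] by (simp add: subalgebra_def)

lemma Fl_measurable_M: "f \<in> borel_measurable (Fl t) \<Longrightarrow> 0 \<le> t \<Longrightarrow> f \<in> borel_measurable M"
  using filtered measurable_from_subalg[of M "Fl t"] by (auto simp: filtered_prob_space_def)

lemma Fl_mono: "f \<in> borel_measurable (Fl s) \<Longrightarrow> 0 \<le> s \<Longrightarrow> s \<le> t \<Longrightarrow> f \<in> borel_measurable (Fl t)"
  using fp_mono[of s t] space_Fl[of s] space_Fl[of t]
  by (intro measurable_from_subalg[of "Fl t" "Fl s" f borel]) (simp_all add: subalgebra_def)

lemma W_adapted: "0 \<le> t \<Longrightarrow> W t \<in> borel_measurable (Fl t)"
  by (rule bm_adapted)

lemma W_measurable: "0 \<le> t \<Longrightarrow> W t \<in> borel_measurable M"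
  using W_adapted Fl_measurable_M by blast

lemma W_continuous: "\<omega> \<in> space M \<Longrightarrow> continuous_on {0..} (\<lambda>t. W t \<omega>)"
  by (rule bm_continuous)

lemma increment_normal:
  "0 \<le> s \<Longrightarrow> s < t \<Longrightarrow>
    distributed M lborel (\<lambda>\<omega>. W t \<omega> - W s \<omega>) (normal_density 0 (sqrt (t - s)))"
  using bm_increment[of s t] by simp

lemma increment_indep:
  assumes st: "0 \<le> s" "s < t" and Y: "Y \<in> borel_measurable (Fl s)"
  shows "indep_var borel Y borel (\<lambda>\<omega>. W t \<omega> - W s \<omega>)"
proof -
  let ?D = "\<lambda>\<omega>. W t \<omega> - W s \<omega>"
  let ?P = "{?D -` B \<inter> space M | B. B \<in> sets borel}"
  have ind: "indep_set (sets (Fl s)) ?P"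
    using bm_increment[of s t] st by simp
  have [measurable]: "random_variable borel ?D" "random_variable borel Y"
    using st W_measurable[of t] W_measurable[of s] Fl_measurable_M[OF Y]
    by (simp_all add: borel_measurable_diff)
  have "Int_stable ?P"
  proof (rule Int_stableI)
    fix A B assume "A \<in> ?P" "B \<in> ?P"
    then obtain A' B' where "A = ?D -` A' \<inter> space M" "B = ?D -` B' \<inter> space M"
      "A' \<in> sets borel" "B' \<in> sets borel" by blast
    then have "A \<inter> B = ?D -` (A' \<inter> B') \<inter> space M" "A' \<inter> B' \<in> sets borel"
      by (simp_all add: vimage_Int Int_ac)
    then show "A \<inter> B \<in> ?P" by (intro CollectI exI[of _ "A' \<inter> B'"] conjI)
  qed
  then have ind': "indep_set (sigma_sets (space M) (sets (Fl s))) (sigma_sets (space M) ?P)"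
    by (rule indep_set_sigma_sets[OF ind sets.Int_stable])
  have "sigma_sets (space M) {Y -` A \<inter> space M | A. A \<in> sets borel} \<subseteq>
      sigma_sets (space M) (sets (Fl s))"
  proof (rule sigma_sets_mono')
    show "{Y -` A \<inter> space M | A. A \<in> sets borel} \<subseteq> sets (Fl s)"
      using measurable_sets[OF Y] space_Fl[of s] st by force
  qed
  with ind' have "indep_set (sigma_sets (space M) {Y -` A \<inter> space M | A. A \<in> sets borel})
      (sigma_sets (space M) ?P)"
    unfolding indep_sets2_eq by blast
  then show ?thesis
    unfolding indep_var_eq by simp
qed

lemma exponential_moment:
  assumes "0 \<le> t"
  shows "integrable M (\<lambda>\<omega>. exp (k * W t \<omega>))"
    and "expectation (\<lambda>\<omega>. exp (k * W t \<omega>)) = exp (k\<^sup>2 * t / 2)"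
proof -
  have W0: "AE \<omega> in M. W 0 \<omega> = 0"
    by (rule bm_start)
  have [measurable]: "W t \<in> borel_measurable M" "W 0 \<in> borel_measurable M"
    using assms W_measurable by auto
  have int: "integrable M (\<lambda>\<omega>. exp (k * (W t \<omega> - W 0 \<omega>))) \<and>
    expectation (\<lambda>\<omega>. exp (k * (W t \<omega> - W 0 \<omega>))) = exp (k\<^sup>2 * t / 2)"
  proof (cases "t = 0")
    case True
    then show ?thesis by (simp add: prob_space)
  next
    case False
    then show ?thesis
      using normal_exponential_moment[OF increment_normal[of 0 t], of k] assms by simp
  qed
  have eq: "AE \<omega> in M. exp (k * (W t \<omega> - W 0 \<omega>)) = exp (k * W t \<omega>)"
    using W0 by eventually_elim simp
  have "integrable M (\<lambda>\<omega>. exp (k * (W t \<omega> - W 0 \<omega>))) \<longleftrightarrow> integrable M (\<lambda>\<omega>. exp (k * W t \<omega>))"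
    by (intro integrable_cong_AE eq) measurable
  with int show "integrable M (\<lambda>\<omega>. exp (k * W t \<omega>))" by blast
  have "expectation (\<lambda>\<omega>. exp (k * (W t \<omega> - W 0 \<omega>))) = expectation (\<lambda>\<omega>. exp (k * W t \<omega>))"
    by (intro integral_cong_AE eq) measurable
  with int show "expectation (\<lambda>\<omega>. exp (k * W t \<omega>)) = exp (k\<^sup>2 * t / 2)" by simp
qed

text \<open>
  The submartingale property of \<open>exp (k W)\<close>, tested against a nonnegative past weight \<open>Y\<close>: the
  increment is \<open>exp (k W\<^sub>s)\<close> times an independent factor whose mean \<open>exp (k\<^sup>2 (t - s) / 2) - 1\<close> is
  nonnegative, for either sign of \<open>k\<close>.
\<close>

lemma exp_W_submartingale:
  assumes "0 \<le> s" "s < t" and Y: "Y \<in> borel_measurable (Fl s)" "\<And>\<omega>. 0 \<le> Y \<omega>"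
    and int: "integrable M (\<lambda>\<omega>. Y \<omega> * exp (k * W s \<omega>))"
  shows "integrable M (\<lambda>\<omega>. Y \<omega> * (exp (k * W t \<omega>) - exp (k * W s \<omega>)))"
    and "0 \<le> expectation (\<lambda>\<omega>. Y \<omega> * (exp (k * W t \<omega>) - exp (k * W s \<omega>)))"
proof -
  let ?V = "\<lambda>\<omega>. Y \<omega> * exp (k * W s \<omega>)" and ?D = "\<lambda>\<omega>. exp (k * (W t \<omega> - W s \<omega>)) - 1"
  note D = normal_exponential_moment[OF increment_normal[OF assms(1,2)], of k]
  have D_int: "integrable M ?D" and D_pos: "0 \<le> expectation ?D"
    using D assms by (auto simp: prob_space)
  have [measurable]: "W s \<in> borel_measurable (Fl s)"
    using W_adapted assms by simp
  have "?V \<in> borel_measurable (Fl s)"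
    using Y(1) by measurable
  from indep_var_compose[OF increment_indep[OF assms(1,2) this], of "\<lambda>x. x" borel "\<lambda>x. exp (k * x) - 1" borel]
  have ind: "indep_var borel ?V borel ?D"
    by (simp add: comp_def)
  have eq: "?V \<omega> * ?D \<omega> = Y \<omega> * (exp (k * W t \<omega>) - exp (k * W s \<omega>))" for \<omega>
    by (simp add: algebra_simps exp_diff)
  show "integrable M (\<lambda>\<omega>. Y \<omega> * (exp (k * W t \<omega>) - exp (k * W s \<omega>)))"
    using indep_var_integrable[OF ind int D_int] unfolding eq .
  have "expectation (\<lambda>\<omega>. ?V \<omega> * ?D \<omega>) = expectation ?V * expectation ?D"
    by (rule indep_var_lebesgue_integral[OF ind int D_int])
  then show "0 \<le> expectation (\<lambda>\<omega>. Y \<omega> * (exp (k * W t \<omega>) - exp (k * W s \<omega>)))"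
    using D_pos Y(2) by (simp only: eq) simp
qed

lemma maximal_on_grid:
  assumes h: "0 < h"
  shows "(\<integral>\<^sup>+\<omega>. ennreal ((Max ((\<lambda>i. exp (k * W (real i * h) \<omega>)) ` {..n}))\<^sup>2) \<partial>M)
     \<le> ennreal (4 * exp (2 * k\<^sup>2 * (real n * h)))"
proof -
  define x where "x i \<omega> = exp (k * W (real i * h) \<omega>)" for i \<omega>
  define m where "m n \<omega> = Max ((\<lambda>i. x i \<omega>) ` {..n})" for n \<omega>
  have x_ad: "x i \<in> borel_measurable (Fl (real j * h))" if "i \<le> j" for i j
  proof -
    have [measurable]: "W (real i * h) \<in> borel_measurable (Fl (real j * h))"
      using h that by (intro Fl_mono[OF W_adapted] mult_right_mono) auto
    show ?thesis unfolding x_def by measurable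
  qed
  have m_ad: "m i \<in> borel_measurable (Fl (real i * h))" for i
    unfolding m_def using x_ad by (intro borel_measurable_Max) auto
  have m_meas[measurable]: "m i \<in> borel_measurable M" for i
    using h by (intro Fl_measurable_M[OF m_ad]) simp
  have x_meas[measurable]: "x i \<in> borel_measurable M" for i
    using h by (intro Fl_measurable_M[OF x_ad[OF order_refl]]) simp
  have xx_int: "integrable M (\<lambda>\<omega>. x i \<omega> * x j \<omega>)" for i j
  proof (rule Bochner_Integration.integrable_bound)
    show "integrable M (\<lambda>\<omega>. exp (2 * k * W (real i * h) \<omega>) + exp (2 * k * W (real j * h) \<omega>))"
      using h by (intro Bochner_Integration.integrable_add exponential_moment) auto
    show "(\<lambda>\<omega>. x i \<omega> * x j \<omega>) \<in> borel_measurable M"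
      by measurable
    have "x i \<omega> * x j \<omega> \<le> (x i \<omega>)\<^sup>2 + (x j \<omega>)\<^sup>2" for \<omega>
    proof -
      have "0 \<le> x i \<omega> * x j \<omega>" by (simp add: x_def)
      then show ?thesis
        using sum_squares_bound[of "x i \<omega>" "x j \<omega>"] by linarith
    qed
    then show "AE \<omega> in M. norm (x i \<omega> * x j \<omega>)
        \<le> norm (exp (2 * k * W (real i * h) \<omega>) + exp (2 * k * W (real j * h) \<omega>))"
      by (simp add: x_def power2_eq_square mult.assoc flip: exp_add)
  qed
  have m_pos: "0 \<le> m i \<omega>" and m_le: "m i \<omega> \<le> (\<Sum>j\<le>i. x j \<omega>)" for i \<omega>
  proof -
    have "m i \<omega> \<in> (\<lambda>i. x i \<omega>) ` {..i}" unfolding m_def by (intro Max_in) auto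
    then obtain j where "j \<le> i" "m i \<omega> = x j \<omega>" by auto
    then show "0 \<le> m i \<omega>" "m i \<omega> \<le> (\<Sum>j\<le>i. x j \<omega>)"
      by (auto simp: x_def intro!: member_le_sum)
  qed
  have mx_int: "integrable M (\<lambda>\<omega>. m i \<omega> * x i \<omega>)" for i
  proof (rule Bochner_Integration.integrable_bound)
    show "integrable M (\<lambda>\<omega>. \<Sum>j\<le>i. x j \<omega> * x i \<omega>)"
      by (rule Bochner_Integration.integrable_sum) (rule xx_int)
    have "m i \<omega> * x i \<omega> \<le> (\<Sum>j\<le>i. x j \<omega> * x i \<omega>)" for \<omega>
      using mult_right_mono[OF m_le[of i \<omega>], of "x i \<omega>"] by (simp add: x_def sum_distrib_right)
    then show "AE \<omega> in M. norm (m i \<omega> * x i \<omega>) \<le> norm (\<Sum>j\<le>i. x j \<omega> * x i \<omega>)"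
      using m_pos by (intro AE_I2) (simp add: abs_mult x_def abs_of_nonneg order_trans[OF _ abs_ge_self])
  qed measurable
  have incr: "integrable M (\<lambda>\<omega>. m i \<omega> * (x (Suc i) \<omega> - x i \<omega>))"
    "0 \<le> expectation (\<lambda>\<omega>. m i \<omega> * (x (Suc i) \<omega> - x i \<omega>))" for i
  proof -
    have "0 \<le> real i * h" "real i * h < real (Suc i) * h"
      using h by simp_all
    note exp_W_submartingale[OF this m_ad m_pos mx_int[unfolded x_def]]
    then show "integrable M (\<lambda>\<omega>. m i \<omega> * (x (Suc i) \<omega> - x i \<omega>))"
      "0 \<le> expectation (\<lambda>\<omega>. m i \<omega> * (x (Suc i) \<omega> - x i \<omega>))"
      unfolding x_def by blast+
  qed
  let ?R = "\<lambda>\<omega>. 4 * (x n \<omega>)\<^sup>2 - 4 * (\<Sum>i<n. m i \<omega> * (x (Suc i) \<omega> - x i \<omega>))"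
  have pw: "(m n \<omega>)\<^sup>2 \<le> ?R \<omega>" for \<omega>
    using maximal_square_le[of "\<lambda>i. x i \<omega>" n] by (simp add: m_def x_def)
  have sq: "(x n \<omega>)\<^sup>2 = exp (2 * k * W (real n * h) \<omega>)" for \<omega>
    by (simp add: x_def power2_eq_square mult.assoc flip: exp_add)
  have E2: "expectation (\<lambda>\<omega>. (x n \<omega>)\<^sup>2) = exp (2 * k\<^sup>2 * (real n * h))" "integrable M (\<lambda>\<omega>. (x n \<omega>)\<^sup>2)"
    unfolding sq using exponential_moment[of "real n * h" "2 * k"] h
    by (auto simp: power2_eq_square algebra_simps)
  have R_int: "integrable M ?R"
    using E2(2) incr(1)
    by (intro Bochner_Integration.integrable_diff integrable_mult_right Bochner_Integration.integrable_sum)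
  have "(\<integral>\<^sup>+\<omega>. ennreal ((m n \<omega>)\<^sup>2) \<partial>M) \<le> (\<integral>\<^sup>+\<omega>. ennreal (?R \<omega>) \<partial>M)"
    using pw by (intro nn_integral_mono ennreal_leI) auto
  also have "\<dots> = ennreal (expectation ?R)"
    by (intro nn_integral_eq_integral R_int AE_I2 order_trans[OF zero_le_power2[of "m n _"] pw])
  also have "expectation ?R = 4 * exp (2 * k\<^sup>2 * (real n * h))
      - 4 * (\<Sum>i<n. expectation (\<lambda>\<omega>. m i \<omega> * (x (Suc i) \<omega> - x i \<omega>)))"
    using E2 incr(1) by (simp add: Bochner_Integration.integral_diff Bochner_Integration.integral_sum)
  also have "ennreal \<dots> \<le> ennreal (4 * exp (2 * k\<^sup>2 * (real n * h)))"
    using incr(2) by (intro ennreal_leI) (simp add: sum_nonneg)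
  finally show ?thesis
    by (simp add: m_def x_def)
qed

text \<open>
  The bound on a grid does not depend on its mesh.  Fatou's lemma carries it to the lower limit over
  finer and finer grids, which dominates \<open>exp (k W\<^sub>t)\<close> for every \<open>t\<close> since paths are continuous.
  As a lower limit of a sequence, this dominating variable is measurable.
\<close>

lemma exp_sup_integrable_one_sided:
  assumes T: "0 < T"
  shows "\<exists>Q. integrable M Q \<and> (AE \<omega> in M. \<forall>t\<in>{0..T}. exp (k * W t \<omega>) \<le> Q \<omega>)"
proof -
  (* half the exponent, because the maximal inequality squares the maximum *)
  define m where "m n \<omega> = ennreal ((Max ((\<lambda>i. exp (k / 2 * W (real i * (T / Suc n)) \<omega>)) ` {..Suc n}))\<^sup>2)"
    for n \<omega>
  define R where "R \<omega> = liminf (\<lambda>n. m n \<omega>)" for \<omega>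
  have [measurable]: "m n \<in> borel_measurable M" for n
    unfolding m_def using T W_measurable
    by (intro measurable_compose[OF _ measurable_ennreal] borel_measurable_power borel_measurable_Max
        borel_measurable_exp borel_measurable_times) auto
  have [measurable]: "R \<in> borel_measurable M"
    unfolding R_def by measurable
  have "(\<integral>\<^sup>+\<omega>. R \<omega> \<partial>M) \<le> liminf (\<lambda>n. \<integral>\<^sup>+\<omega>. m n \<omega> \<partial>M)"
    unfolding R_def by (rule nn_integral_liminf) measurable
  also have "\<dots> \<le> liminf (\<lambda>n::nat. ennreal (4 * exp (2 * (k/2)\<^sup>2 * T)))"
  proof (intro Liminf_mono always_eventually allI)
    fix n show "(\<integral>\<^sup>+\<omega>. m n \<omega> \<partial>M) \<le> ennreal (4 * exp (2 * (k/2)\<^sup>2 * T))"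
      unfolding m_def using maximal_on_grid[of "T / Suc n" "k/2" "Suc n"] T by simp
  qed
  also have "\<dots> < \<infinity>"
    by (simp add: Liminf_const)
  finally have R_fin: "(\<integral>\<^sup>+\<omega>. R \<omega> \<partial>M) \<noteq> \<infinity>" by simp
  have bound: "ennreal (exp (k * W t \<omega>)) \<le> R \<omega>" if t: "t \<in> {0..T}" and \<omega>: "\<omega> \<in> space M" for t \<omega>
  proof -
    define i where "i n = nat \<lfloor>t * Suc n / T\<rfloor>" for n
    define s where "s n = real (i n) * (T / Suc n)" for n
    have i_le: "i n \<le> Suc n" for n
    proof -
      have "t * Suc n / T \<le> real (Suc n)" using t T by (simp add: divide_le_eq mult_right_mono)
      then show ?thesis unfolding i_def by linarith
    qed
    have "s \<longlonglongrightarrow> t"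
      unfolding s_def[abs_def] i_def using t T by (intro grid_floor_tendsto) auto
    moreover have "s n \<ge> 0" for n using T by (simp add: s_def)
    ultimately have "(\<lambda>n. W (s n) \<omega>) \<longlonglongrightarrow> W t \<omega>"
      using t W_continuous[OF \<omega>] by (intro continuous_on_tendsto_compose[of "{0..}" "\<lambda>t. W t \<omega>"]) auto
    then have "(\<lambda>n. ennreal (exp (k * W (s n) \<omega>))) \<longlonglongrightarrow> ennreal (exp (k * W t \<omega>))"
      by (intro tendsto_ennrealI tendsto_exp tendsto_mult tendsto_const)
    then have "ennreal (exp (k * W t \<omega>)) = liminf (\<lambda>n. ennreal (exp (k * W (s n) \<omega>)))"
      by (intro lim_imp_Liminf[symmetric]) simp_all
    also have "\<dots> \<le> R \<omega>"
      unfolding R_def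
    proof (intro Liminf_mono always_eventually allI)
      fix n
      let ?g = "\<lambda>i. exp (k / 2 * W (real i * (T / Suc n)) \<omega>)"
      have "?g (i n) \<le> Max (?g ` {..Suc n})"
        using i_le by (intro Max_ge) auto
      then have "(?g (i n))\<^sup>2 \<le> (Max (?g ` {..Suc n}))\<^sup>2"
        by (intro power_mono) auto
      moreover have "exp (k * W (s n) \<omega>) = (?g (i n))\<^sup>2"
        by (simp add: s_def power2_eq_square flip: exp_add)
      ultimately show "ennreal (exp (k * W (s n) \<omega>)) \<le> m n \<omega>"
        unfolding m_def by (intro ennreal_leI) simp
    qed
    finally show ?thesis .
  qed
  have "integrable M (\<lambda>\<omega>. enn2real (R \<omega>))"
  proof (rule integrableI_bounded)
    have "(\<integral>\<^sup>+\<omega>. ennreal (norm (enn2real (R \<omega>))) \<partial>M) \<le> (\<integral>\<^sup>+\<omega>. R \<omega> \<partial>M)"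
      by (intro nn_integral_mono) (simp add: ennreal_enn2real_if)
    then show "(\<integral>\<^sup>+\<omega>. ennreal (norm (enn2real (R \<omega>))) \<partial>M) < \<infinity>"
      using R_fin by (simp add: less_top order_le_less_trans)
  qed measurable
  moreover have "AE \<omega> in M. \<forall>t\<in>{0..T}. exp (k * W t \<omega>) \<le> enn2real (R \<omega>)"
  proof -
    have "AE \<omega> in M. R \<omega> \<noteq> \<infinity>"
      using R_fin by (intro nn_integral_PInf_AE) measurable
    then show ?thesis
    proof (rule AE_mp, intro AE_I2 impI ballI)
      fix \<omega> t assume "\<omega> \<in> space M" "R \<omega> \<noteq> \<infinity>" "t \<in> {0..T}"
      with bound[of t \<omega>] enn2real_mono[of "ennreal (exp (k * W t \<omega>))" "R \<omega>"]
      show "exp (k * W t \<omega>) \<le> enn2real (R \<omega>)" by (simp add: less_top)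
    qed
  qed
  ultimately show ?thesis by blast
qed

lemma exp_abs_sup_integrable:
  assumes T: "0 < T" and k: "0 < k"
  shows "\<exists>Q. integrable M Q \<and> (AE \<omega> in M. \<forall>t\<in>{0..T}. exp (k * \<bar>W t \<omega>\<bar>) \<le> Q \<omega>)"
proof -
  from exp_sup_integrable_one_sided[OF T, of k] exp_sup_integrable_one_sided[OF T, of "-k"]
  obtain Q1 Q2 where Q: "integrable M Q1" "AE \<omega> in M. \<forall>t\<in>{0..T}. exp (k * W t \<omega>) \<le> Q1 \<omega>"
    "integrable M Q2" "AE \<omega> in M. \<forall>t\<in>{0..T}. exp (- k * W t \<omega>) \<le> Q2 \<omega>" by blast
  show ?thesis
  proof (intro exI conjI)
    show "integrable M (\<lambda>\<omega>. \<bar>Q1 \<omega>\<bar> + \<bar>Q2 \<omega>\<bar>)" using Q by auto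
    show "AE \<omega> in M. \<forall>t\<in>{0..T}. exp (k * \<bar>W t \<omega>\<bar>) \<le> \<bar>Q1 \<omega>\<bar> + \<bar>Q2 \<omega>\<bar>"
      using Q(2,4)
    proof eventually_elim
      case (elim \<omega>)
      show ?case
      proof
        fix t assume "t \<in> {0..T}"
        with elim have "exp (k * W t \<omega>) \<le> Q1 \<omega>" "exp (- k * W t \<omega>) \<le> Q2 \<omega>" by auto
        then show "exp (k * \<bar>W t \<omega>\<bar>) \<le> \<bar>Q1 \<omega>\<bar> + \<bar>Q2 \<omega>\<bar>"
          by (cases "0 \<le> W t \<omega>") (auto simp: abs_if)
      qed
    qed
  qed
qed

text \<open>
  Continuity of the paths makes \<open>W\<close> the pointwise limit of processes that are constant between grid
  points.
\<close>

lemma W_jointly_measurable: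
  "(\<lambda>(t, \<omega>). W t \<omega>) \<in> borel_measurable (lebesgue_on {0..T} \<Otimes>\<^sub>M M)"
proof (rule borel_measurable_LIMSEQ_real)
  let ?s = "\<lambda>n t. real (nat \<lfloor>t * real (Suc n) / 1\<rfloor>) * (1 / real (Suc n))"
  fix n
  have t: "(\<lambda>q. fst q) \<in> borel_measurable (lebesgue_on {0..T} \<Otimes>\<^sub>M M)"
    using measurable_compose[OF measurable_fst id_borel_measurable_lebesgue_on] by simp
  show "(\<lambda>q. W (?s n (fst q)) (snd q)) \<in> borel_measurable (lebesgue_on {0..T} \<Otimes>\<^sub>M M)"
  proof (rule measurable_compose_countable[where f = "\<lambda>i q. W (real i * (1 / real (Suc n))) (snd q)"])
    show "(\<lambda>q. W (real i * (1 / real (Suc n))) (snd q)) \<in> borel_measurable (lebesgue_on {0..T} \<Otimes>\<^sub>M M)" for i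
      by (rule measurable_compose[OF measurable_snd W_measurable]) simp
    show "(\<lambda>q. nat \<lfloor>fst q * real (Suc n) / 1\<rfloor>) \<in> (lebesgue_on {0..T} \<Otimes>\<^sub>M M) \<rightarrow>\<^sub>M count_space UNIV"
      using t by measurable
  qed
next
  let ?s = "\<lambda>n t. real (nat \<lfloor>t * real (Suc n) / 1\<rfloor>) * (1 / real (Suc n))"
  fix q assume "q \<in> space (lebesgue_on {0..T} \<Otimes>\<^sub>M M)"
  then obtain t \<omega> where q: "q = (t, \<omega>)" "t \<in> {0..T}" "\<omega> \<in> space M"
    by (auto simp: space_pair_measure)
  have "(\<lambda>n. ?s n t) \<longlonglongrightarrow> t"
    using q by (intro grid_floor_tendsto) auto
  then have "(\<lambda>n. W (?s n t) \<omega>) \<longlonglongrightarrow> W t \<omega>"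
    using q W_continuous[of \<omega>] by (intro continuous_on_tendsto_compose[of "{0..}" "\<lambda>t. W t \<omega>"]) auto
  then show "(\<lambda>n. W (?s n (fst q)) (snd q)) \<longlonglongrightarrow> (case q of (t, \<omega>) \<Rightarrow> W t \<omega>)"
    by (simp add: q)
qed

end

section \<open>Moments of time integrals, and Fermat's rule under the integral sign\<close>

text \<open>
  The graph of the convex function \<open>x powr p\<close> lies above its tangent at \<open>c\<close>; equivalently, Young's
  inequality for \<open>x\<close> and \<open>c powr (p - 1)\<close>.
\<close>

lemma powr_tangent_le:
  fixes x c p :: real
  assumes "1 < p" "0 \<le> x" "0 \<le> c"
  shows "p * c powr (p - 1) * x \<le> x powr p + (p - 1) * c powr p"
proof -
  have "x * c powr (p - 1) \<le> x powr p / p + (c powr (p - 1)) powr (p / (p - 1)) / (p / (p - 1))"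
    using assms by (intro Youngs_inequality) (auto simp: field_simps)
  also have "(c powr (p - 1)) powr (p / (p - 1)) = c powr p"
    using assms by (simp add: powr_powr)
  finally show ?thesis
    using assms by (simp add: field_simps)
qed

lemma (in pair_sigma_finite) AE_snd_imp_AE_pair:
  assumes "AE y in M2. P y"
  shows "AE x in M1 \<Otimes>\<^sub>M M2. P (snd x)"
proof -
  obtain N where N: "{y \<in> space M2. \<not> P y} \<subseteq> N" "N \<in> sets M2" "emeasure M2 N = 0"
    using assms by (auto elim: AE_E)
  show ?thesis
  proof (rule AE_I)
    show "{x \<in> space (M1 \<Otimes>\<^sub>M M2). \<not> P (snd x)} \<subseteq> space M1 \<times> N"
      using N by (auto simp: space_pair_measure)
    show "emeasure (M1 \<Otimes>\<^sub>M M2) (space M1 \<times> N) = 0"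
      using N M2.emeasure_pair_measure_Times[of "space M1" M1 N] by simp
    show "space M1 \<times> N \<in> sets (M1 \<Otimes>\<^sub>M M2)"
      using N by simp
  qed
qed

lemma (in pair_sigma_finite) integrable_product_real:
  fixes f :: "'a \<Rightarrow> real" and g :: "'b \<Rightarrow> real"
  assumes f: "integrable M1 f" and g: "integrable M2 g"
  shows "integrable (M1 \<Otimes>\<^sub>M M2) (\<lambda>x. f (fst x) * g (snd x))"
proof (rule Fubini_integrable)
  have [measurable]: "f \<in> borel_measurable M1" "g \<in> borel_measurable M2" using assms by auto
  show "(\<lambda>x. f (fst x) * g (snd x)) \<in> borel_measurable (M1 \<Otimes>\<^sub>M M2)" by measurable
  show "integrable M1 (\<lambda>x. \<integral>y. norm (f (fst (x, y)) * g (snd (x, y))) \<partial>M2)"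
    using f by (simp add: abs_mult)
  show "AE x in M1. integrable M2 (\<lambda>y. f (fst (x, y)) * g (snd (x, y)))"
    using g by simp
qed

text \<open>
  Minkowski's integral inequality, in the qualitative form that a function whose \<open>L\<^sup>p\<close> norm over \<open>y\<close> is
  bounded by an integrable \<open>n x\<close> has its \<open>x\<close>-integral in \<open>L\<^sup>p\<close>.  By the tangent inequality for
  \<open>\<bar>f\<bar> / n\<close>, weighted with \<open>n\<close>, a multiple of \<open>\<bar>f\<bar>\<close> lies below \<open>g = \<bar>f\<bar> powr p * n powr (1 - p)\<close> plus a
  multiple of \<open>n\<close>, and \<open>g\<close> has integral at most that of \<open>n\<close>.  Choosing the point of tangency as the
  \<open>n\<close>-weighted average of \<open>\<bar>f\<bar> / n\<close>, up to normalization, makes this Jensen's inequality.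
\<close>

lemma (in pair_sigma_finite) integral_moment_finite:
  fixes f :: "'a \<Rightarrow> 'b \<Rightarrow> real" and n :: "'a \<Rightarrow> real"
  assumes f[measurable]: "case_prod f \<in> borel_measurable (M1 \<Otimes>\<^sub>M M2)"
    and p: "1 < p" and n: "integrable M1 n" and n_pos: "\<And>x. x \<in> space M1 \<Longrightarrow> 0 < n x"
    and moment: "\<And>x. x \<in> space M1 \<Longrightarrow> (\<integral>\<^sup>+y. ennreal (\<bar>f x y\<bar> powr p) \<partial>M2) \<le> ennreal (n x powr p)"
  shows "AE y in M2. integrable M1 (\<lambda>x. f x y)"
    and "integrable M2 (\<lambda>y. (\<integral>x. \<bar>f x y\<bar> \<partial>M1) powr p)"
proof -
  define g where "g x y = \<bar>f x y\<bar> powr p * n x powr (1 - p)" for x y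
  have n_meas[measurable]: "n \<in> borel_measurable M1" using n by simp
  have g_meas[measurable]: "case_prod g \<in> borel_measurable (M1 \<Otimes>\<^sub>M M2)"
    unfolding g_def by measurable
  have g_nn: "0 \<le> g x y" for x y by (simp add: g_def)
  have g_int: "integrable (M1 \<Otimes>\<^sub>M M2) (case_prod g)"
  proof (rule integrableI_bounded)
    have "(\<integral>\<^sup>+z. ennreal (norm (case_prod g z)) \<partial>(M1 \<Otimes>\<^sub>M M2))
        = (\<integral>\<^sup>+x. (\<integral>\<^sup>+y. ennreal (g x y) \<partial>M2) \<partial>M1)"
      using g_nn by (subst M2.nn_integral_fst[symmetric]) (simp_all add: split_beta')
    also have "\<dots> \<le> (\<integral>\<^sup>+x. ennreal (n x) \<partial>M1)"
    proof (rule nn_integral_mono)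
      fix x assume x: "x \<in> space M1"
      have [measurable]: "f x \<in> borel_measurable M2"
        using measurable_Pair2[OF f x] by simp
      have "(\<integral>\<^sup>+y. ennreal (g x y) \<partial>M2) = (\<integral>\<^sup>+y. ennreal (\<bar>f x y\<bar> powr p) * ennreal (n x powr (1 - p)) \<partial>M2)"
        unfolding g_def by (simp add: ennreal_mult)
      also have "\<dots> = (\<integral>\<^sup>+y. ennreal (\<bar>f x y\<bar> powr p) \<partial>M2) * ennreal (n x powr (1 - p))"
        by (rule nn_integral_multc) measurable
      also have "\<dots> \<le> ennreal (n x powr p) * ennreal (n x powr (1 - p))"
        using moment[OF x] by (rule mult_right_mono) simp
      also have "\<dots> = ennreal (n x)"
        using n_pos[OF x] by (simp flip: ennreal_mult powr_add)
      finally show "(\<integral>\<^sup>+y. ennreal (g x y) \<partial>M2) \<le> ennreal (n x)" .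
    qed
    also have "\<dots> < \<infinity>"
    proof -
      have "(\<integral>\<^sup>+x. ennreal (n x) \<partial>M1) = ennreal (\<integral>x. n x \<partial>M1)"
        using n n_pos by (intro nn_integral_eq_integral) (auto intro: less_imp_le)
      then show ?thesis by simp
    qed
    finally show "(\<integral>\<^sup>+z. ennreal (norm (case_prod g z)) \<partial>(M1 \<Otimes>\<^sub>M M2)) < \<infinity>" .
  qed measurable
  have key: "p * c powr (p - 1) * \<bar>f x y\<bar> \<le> g x y + (p - 1) * c powr p * n x"
    if "x \<in> space M1" "0 \<le> c" for x y c
  proof -
    have nx: "0 < n x" using n_pos that by simp
    have "p * c powr (p - 1) * (\<bar>f x y\<bar> / n x) \<le> (\<bar>f x y\<bar> / n x) powr p + (p - 1) * c powr p"
      using p nx that by (intro powr_tangent_le) auto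
    then have "n x * (p * c powr (p - 1) * (\<bar>f x y\<bar> / n x)) \<le> n x * ((\<bar>f x y\<bar> / n x) powr p + (p - 1) * c powr p)"
      using nx by (intro mult_left_mono) auto
    moreover have "n x * (\<bar>f x y\<bar> / n x) powr p = g x y"
      using nx by (simp add: g_def powr_divide powr_diff)
    ultimately show ?thesis
      using nx by (simp add: distrib_left mult_ac)
  qed
  have g_slice: "AE y in M2. integrable M1 (\<lambda>x. g x y)"
    by (rule AE_integrable_snd[OF g_int])
  show f_int: "AE y in M2. integrable M1 (\<lambda>x. f x y)"
    using g_slice AE_space
  proof eventually_elim
    case (elim y)
    have "(\<lambda>x. f x y) \<in> borel_measurable M1"
      using measurable_Pair1[OF f elim(2)] by simp
    moreover have "AE x in M1. norm (f x y) \<le> norm (g x y + (p - 1) * n x)"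
    proof (rule AE_I2)
      fix x assume x: "x \<in> space M1"
      have "\<bar>f x y\<bar> \<le> p * \<bar>f x y\<bar>" using p mult_right_mono[of 1 p "\<bar>f x y\<bar>"] by simp
      also have "\<dots> \<le> g x y + (p - 1) * n x" using key[OF x, of 1 y] by simp
      finally show "norm (f x y) \<le> norm (g x y + (p - 1) * n x)" by simp
    qed
    ultimately show ?case
      by (rule Bochner_Integration.integrable_bound[OF
            Bochner_Integration.integrable_add[OF elim(1) integrable_mult_right[OF n]]])
  qed
  (* the summand 1 makes N positive even if the measure M1 is null *)
  define N where "N = (\<integral>x. n x \<partial>M1) + 1"
  have N: "0 < N" "(\<integral>x. n x \<partial>M1) \<le> N"
  proof -
    have "0 \<le> (\<integral>x. n x \<partial>M1)"
      using n_pos by (intro integral_nonneg_AE AE_I2) (auto intro: less_imp_le)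
    then show "0 < N" "(\<integral>x. n x \<partial>M1) \<le> N"
      unfolding N_def by simp_all
  qed
  show "integrable M2 (\<lambda>y. (\<integral>x. \<bar>f x y\<bar> \<partial>M1) powr p)"
  proof (rule Bochner_Integration.integrable_bound)
    show "integrable M2 (\<lambda>y. N powr (p - 1) * (\<integral>x. g x y \<partial>M1))"
      by (intro integrable_mult_right integrable_snd[OF g_int])
    show "(\<lambda>y. (\<integral>x. \<bar>f x y\<bar> \<partial>M1) powr p) \<in> borel_measurable M2"
      by measurable
    show "AE y in M2. norm ((\<integral>x. \<bar>f x y\<bar> \<partial>M1) powr p) \<le> norm (N powr (p - 1) * (\<integral>x. g x y \<partial>M1))"
      using g_slice f_int
    proof eventually_elim
      case (elim y)
      define Z where "Z = (\<integral>x. \<bar>f x y\<bar> \<partial>M1)"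
      have Z: "0 \<le> Z" unfolding Z_def by simp
      define c where "c = Z / N"
      have c: "0 \<le> c" using Z N by (simp add: c_def)
      have "integrable M1 (\<lambda>x. p * c powr (p - 1) * \<bar>f x y\<bar>)"
        "integrable M1 (\<lambda>x. g x y + (p - 1) * c powr p * n x)"
        by (intro integrable_mult_right integrable_abs elim(2))
          (intro Bochner_Integration.integrable_add integrable_mult_right n elim(1))
      then have "(\<integral>x. p * c powr (p - 1) * \<bar>f x y\<bar> \<partial>M1) \<le> (\<integral>x. g x y + (p - 1) * c powr p * n x \<partial>M1)"
        by (rule integral_mono) (rule key[OF _ c])
      then have "p * c powr (p - 1) * Z \<le> (\<integral>x. g x y \<partial>M1) + (p - 1) * c powr p * (\<integral>x. n x \<partial>M1)"
        using elim n by (simp add: Z_def)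
      also have "\<dots> \<le> (\<integral>x. g x y \<partial>M1) + (p - 1) * c powr p * N"
        using N p by (intro add_left_mono mult_left_mono) auto
      finally have "p * c powr (p - 1) * Z \<le> (\<integral>x. g x y \<partial>M1) + (p - 1) * c powr p * N" .
      moreover have "c powr p * N = c powr (p - 1) * Z"
        using Z N by (cases "Z = 0") (simp_all add: c_def powr_diff)
      ultimately have "p * (c powr (p - 1) * Z) \<le> (\<integral>x. g x y \<partial>M1) + (p - 1) * (c powr (p - 1) * Z)"
        by (simp add: mult.assoc)
      then have "c powr (p - 1) * Z \<le> (\<integral>x. g x y \<partial>M1)"
        by (simp add: algebra_simps)
      then have "N powr (p - 1) * (c powr (p - 1) * Z) \<le> N powr (p - 1) * (\<integral>x. g x y \<partial>M1)"
        by (rule mult_left_mono) simp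
      moreover have "N powr (p - 1) * (c powr (p - 1) * Z) = Z powr p"
        using Z N by (cases "Z = 0") (simp_all add: c_def powr_divide powr_diff)
      ultimately show ?case
        using Z by (simp add: Z_def)
    qed
  qed
qed

text \<open>
  Instead of Hoelder's inequality, compare the two factors directly: with \<open>\<theta> = \<kappa> / (p - \<alpha>)\<close>, either
  \<open>S powr \<theta> \<le> c + Z\<close>, and the product is at most \<open>(c + Z) powr p\<close>, or \<open>c + Z < S powr \<theta>\<close>, and it is
  at most \<open>S powr (\<kappa> + \<theta> \<alpha>)\<close>, whose exponent is \<open>\<kappa> p / (p - \<alpha>)\<close>.
\<close>

lemma integrable_powr_mult_powr:
  fixes S Z :: "'a \<Rightarrow> real"
  assumes [measurable]: "S \<in> borel_measurable M" "Z \<in> borel_measurable M"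
    and fin: "finite_measure M"
    and S: "\<And>x. 1 \<le> S x" and Z: "\<And>x. 0 \<le> Z x" and c: "0 \<le> c"
    and \<alpha>: "0 \<le> \<alpha>" "\<alpha> < p" and \<kappa>: "0 \<le> \<kappa>"
    and Zp: "integrable M (\<lambda>x. Z x powr p)"
    and Sp: "integrable M (\<lambda>x. S x powr (\<kappa> * p / (p - \<alpha>)))"
  shows "integrable M (\<lambda>x. S x powr \<kappa> * (c + Z x) powr \<alpha>)"
proof (rule Bochner_Integration.integrable_bound)
  interpret finite_measure M by fact
  show "integrable M (\<lambda>x. 2 powr p * (c powr p + Z x powr p) + S x powr (\<kappa> * p / (p - \<alpha>)))"
    using Zp Sp by simp
  show "(\<lambda>x. S x powr \<kappa> * (c + Z x) powr \<alpha>) \<in> borel_measurable M"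
    by measurable
  have "S x powr \<kappa> * (c + Z x) powr \<alpha>
      \<le> 2 powr p * (c powr p + Z x powr p) + S x powr (\<kappa> * p / (p - \<alpha>))" for x
  proof -
    let ?z = "c + Z x" and ?\<theta> = "\<kappa> / (p - \<alpha>)"
    have z: "0 \<le> ?z" using c Z[of x] by simp
    have zp: "?z powr p \<le> 2 powr p * (c powr p + Z x powr p)"
    proof -
      have "?z powr p \<le> (2 * max c (Z x)) powr p"
        using z \<alpha> by (intro powr_mono2) auto
      also have "\<dots> = 2 powr p * max c (Z x) powr p"
        using c by (simp add: powr_mult)
      also have "\<dots> \<le> 2 powr p * (c powr p + Z x powr p)"
        by (intro mult_left_mono) (auto simp: max_def)
      finally show ?thesis .
    qed
    show ?thesis
    proof (cases "S x powr ?\<theta> \<le> ?z")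
      case True
      have "S x powr \<kappa> = (S x powr ?\<theta>) powr (p - \<alpha>)"
        using \<alpha> by (simp add: powr_powr)
      also have "\<dots> \<le> ?z powr (p - \<alpha>)"
        using True \<alpha> by (intro powr_mono2) auto
      finally have "S x powr \<kappa> * ?z powr \<alpha> \<le> ?z powr (p - \<alpha>) * ?z powr \<alpha>"
        by (rule mult_right_mono) simp
      also have "\<dots> = ?z powr p" by (simp flip: powr_add)
      also note zp
      finally show ?thesis
        by (simp add: add_increasing2)
    next
      case False
      then have "?z powr \<alpha> \<le> (S x powr ?\<theta>) powr \<alpha>"
        using z \<alpha> by (intro powr_mono2) auto
      then have "S x powr \<kappa> * ?z powr \<alpha> \<le> S x powr \<kappa> * (S x powr ?\<theta>) powr \<alpha>"
        by (rule mult_left_mono) simp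
      also have "\<dots> = S x powr (\<kappa> + ?\<theta> * \<alpha>)"
        by (simp add: powr_powr powr_add)
      also have "\<kappa> + ?\<theta> * \<alpha> = \<kappa> * p / (p - \<alpha>)"
        using \<alpha> by (simp add: field_simps)
      finally show ?thesis
        by (simp add: add_increasing)
    qed
  qed
  then show "AE x in M. norm (S x powr \<kappa> * (c + Z x) powr \<alpha>)
      \<le> norm (2 powr p * (c powr p + Z x powr p) + S x powr (\<kappa> * p / (p - \<alpha>)))"
    by (intro AE_I2) (simp add: abs_mult)
qed

text \<open>
  Only nonnegative \<open>\<epsilon>\<close> enter the bound, so that both signs of the derivative follow from this one-sided
  version, applied to \<open>\<Phi>\<close> and to its reflection in \<open>\<epsilon>\<close>.  The difference quotients are bounded by \<open>w\<close>
  through the mean value theorem, hence converge in the mean.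
\<close>

lemma first_variation_nonneg:
  fixes \<Phi> \<Phi>' :: "'a \<Rightarrow> real \<Rightarrow> real" and w :: "'a \<Rightarrow> real"
  assumes meas[measurable]: "\<And>\<epsilon>. (\<lambda>x. \<Phi> x \<epsilon>) \<in> borel_measurable N" "(\<lambda>x. \<Phi>' x 0) \<in> borel_measurable N"
    and nonneg: "\<And>x \<epsilon>. x \<in> space N \<Longrightarrow> 0 \<le> \<Phi> x \<epsilon>"
    and deriv: "\<And>x \<epsilon>. x \<in> space N \<Longrightarrow> (\<Phi> x has_real_derivative \<Phi>' x \<epsilon>) (at \<epsilon>)"
    and bound: "AE x in N. \<forall>\<epsilon>\<in>{0..1}. \<bar>\<Phi>' x \<epsilon>\<bar> \<le> w x" and w: "integrable N w"
    and int: "integrable N (\<lambda>x. \<Phi> x 0)"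
    and minimal: "\<And>\<epsilon>. (\<integral>\<^sup>+x. ennreal (\<Phi> x 0) \<partial>N) \<le> (\<integral>\<^sup>+x. ennreal (\<Phi> x \<epsilon>) \<partial>N)"
  shows "0 \<le> (\<integral>x. \<Phi>' x 0 \<partial>N)"
proof -
  define q where "q n x = (\<Phi> x (1 / real (Suc n)) - \<Phi> x 0) / (1 / real (Suc n))" for n x
  have [measurable]: "q n \<in> borel_measurable N" for n
    unfolding q_def by measurable
  have q_lim: "(\<lambda>n. q n x) \<longlonglongrightarrow> \<Phi>' x 0" if x: "x \<in> space N" for x
  proof -
    have "((\<lambda>h. (\<Phi> x (0 + h) - \<Phi> x 0) / h) \<longlongrightarrow> \<Phi>' x 0) (at 0)"
      using deriv[OF x, of 0] by (simp add: DERIV_def)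
    moreover have "filterlim (\<lambda>n. 1 / real (Suc n)) (at 0) sequentially"
      unfolding filterlim_at using LIMSEQ_Suc[OF lim_const_over_n[of "1::real"]] by simp
    ultimately have "(\<lambda>n. (\<Phi> x (0 + 1 / real (Suc n)) - \<Phi> x 0) / (1 / real (Suc n))) \<longlonglongrightarrow> \<Phi>' x 0"
      by (rule filterlim_compose)
    then show ?thesis by (simp add: q_def)
  qed
  have q_bound: "AE x in N. norm (q n x) \<le> w x" for n
    using bound AE_space
  proof eventually_elim
    case (elim x)
    let ?h = "1 / real (Suc n)"
    have h: "0 < ?h" "?h \<le> 1" by simp_all
    obtain \<xi> where \<xi>: "0 < \<xi>" "\<xi> < ?h" "\<Phi> x ?h - \<Phi> x 0 = (?h - 0) * \<Phi>' x \<xi>"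
      using MVT2[OF h(1), of "\<Phi> x" "\<Phi>' x"] deriv[OF elim(2)] by blast
    have "q n x = \<Phi>' x \<xi>"
      using \<xi>(3) h(1) unfolding q_def by (simp del: of_nat_Suc)
    then show ?case
      using elim(1) \<xi>(1) less_imp_le[OF less_le_trans[OF \<xi>(2) h(2)]] by simp
  qed
  have lim_AE: "AE x in N. (\<lambda>n. q n x) \<longlonglongrightarrow> \<Phi>' x 0"
    using q_lim by simp
  have q_int: "integrable N (q n)" for n
    by (rule integrable_dominated_convergence2[where s = q and f = "\<lambda>x. \<Phi>' x 0" and w = w])
      (use w lim_AE q_bound in measurable)
  have "0 \<le> (\<integral>x. q n x \<partial>N)" for n
  proof -
    let ?h = "1 / real (Suc n)"
    have eq: "\<Phi> x ?h = \<Phi> x 0 + ?h * q n x" for x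
      unfolding q_def by (simp del: of_nat_Suc)
    have int_h: "integrable N (\<lambda>x. \<Phi> x ?h)"
      unfolding eq using int q_int[of n] by (intro Bochner_Integration.integrable_add integrable_mult_right)
    have "ennreal (\<integral>x. \<Phi> x 0 \<partial>N) \<le> ennreal (\<integral>x. \<Phi> x ?h \<partial>N)"
      using minimal[of ?h] nn_integral_eq_integral[OF int] nn_integral_eq_integral[OF int_h] nonneg by auto
    then have "(\<integral>x. \<Phi> x 0 \<partial>N) \<le> (\<integral>x. \<Phi> x ?h \<partial>N)"
      using nonneg by (subst (asm) ennreal_le_iff) (auto intro: integral_nonneg_AE)
    also have "\<dots> = (\<integral>x. \<Phi> x 0 \<partial>N) + ?h * (\<integral>x. q n x \<partial>N)"
      unfolding eq using int q_int[of n] by (simp del: of_nat_Suc)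
    finally show ?thesis
      by (simp add: zero_le_divide_iff del: of_nat_Suc)
  qed
  moreover have "(\<lambda>n. \<integral>x. q n x \<partial>N) \<longlonglongrightarrow> (\<integral>x. \<Phi>' x 0 \<partial>N)"
    by (rule integral_dominated_convergence[where w = w]) (use w lim_AE q_bound in measurable)
  ultimately show ?thesis
    by (intro LIMSEQ_le_const) auto
qed

lemma first_variation_eq_zero:
  fixes \<Phi> \<Phi>' :: "'a \<Rightarrow> real \<Rightarrow> real" and w :: "'a \<Rightarrow> real"
  assumes meas: "\<And>\<epsilon>. (\<lambda>x. \<Phi> x \<epsilon>) \<in> borel_measurable N" "(\<lambda>x. \<Phi>' x 0) \<in> borel_measurable N"
    and nonneg: "\<And>x \<epsilon>. x \<in> space N \<Longrightarrow> 0 \<le> \<Phi> x \<epsilon>"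
    and deriv: "\<And>x \<epsilon>. x \<in> space N \<Longrightarrow> (\<Phi> x has_real_derivative \<Phi>' x \<epsilon>) (at \<epsilon>)"
    and bound: "AE x in N. \<forall>\<epsilon>\<in>{-1..1}. \<bar>\<Phi>' x \<epsilon>\<bar> \<le> w x" and w: "integrable N w"
    and int: "integrable N (\<lambda>x. \<Phi> x 0)"
    and minimal: "\<And>\<epsilon>. (\<integral>\<^sup>+x. ennreal (\<Phi> x 0) \<partial>N) \<le> (\<integral>\<^sup>+x. ennreal (\<Phi> x \<epsilon>) \<partial>N)"
  shows "(\<integral>x. \<Phi>' x 0 \<partial>N) = 0"
proof (rule antisym)
  show "0 \<le> (\<integral>x. \<Phi>' x 0 \<partial>N)"
  proof (rule first_variation_nonneg[OF meas nonneg deriv _ w int minimal])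
    show "AE x in N. \<forall>\<epsilon>\<in>{0..1}. \<bar>\<Phi>' x \<epsilon>\<bar> \<le> w x"
      using bound by eventually_elim auto
  qed
  have "0 \<le> (\<integral>x. (\<lambda>\<epsilon>. - \<Phi>' x (- \<epsilon>)) 0 \<partial>N)"
  proof (rule first_variation_nonneg[where \<Phi> = "\<lambda>x \<epsilon>. \<Phi> x (- \<epsilon>)" and w = w])
    fix x \<epsilon> assume "x \<in> space N"
    from DERIV_mirror[of "\<Phi> x" "\<Phi>' x (- \<epsilon>)" \<epsilon>] deriv[OF this, of "- \<epsilon>"]
    show "((\<lambda>\<epsilon>. \<Phi> x (- \<epsilon>)) has_real_derivative - \<Phi>' x (- \<epsilon>)) (at \<epsilon>)"
      by simp
  next
    show "AE x in N. \<forall>\<epsilon>\<in>{0..1}. \<bar>- \<Phi>' x (- \<epsilon>)\<bar> \<le> w x"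
      using bound by eventually_elim auto
  qed (use meas nonneg w int minimal in auto)
  then show "(\<integral>x. \<Phi>' x 0 \<partial>N) \<le> 0" by simp
qed

section \<open>Linear response of a bounded multiplicative flow\<close>

text \<open>
  The flow \<open>E\<close> carries a unit of forcing injected at time \<open>s\<close> to \<open>E t / E s\<close> at time \<open>t\<close>.  The random
  variable \<open>S\<close> bounds whole paths of \<open>E\<close> and \<open>1 / E\<close>; thereby time and chance separate in all later
  estimates.
\<close>

locale random_flow = prob_space M
  for M :: "'a measure" +
  fixes T :: real and E :: "real \<Rightarrow> 'a \<Rightarrow> real" and S :: "'a \<Rightarrow> real"
  assumes T_pos: "0 < T"
    and E_measurable[measurable]: "case_prod E \<in> borel_measurable (lebesgue_on {0..T} \<Otimes>\<^sub>M M)"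
    and E_continuous: "\<And>\<omega>. \<omega> \<in> space M \<Longrightarrow> continuous_on {0..T} (\<lambda>t. E t \<omega>)"
    and E_pos: "\<And>t \<omega>. 0 < E t \<omega>"
    and S_measurable[measurable]: "S \<in> borel_measurable M"
    and S_ge_1: "\<And>\<omega>. 1 \<le> S \<omega>"
    and E_bounds: "AE \<omega> in M. \<forall>t\<in>{0..T}. E t \<omega> \<le> S \<omega> \<and> 1 / E t \<omega> \<le> S \<omega>"
begin

abbreviation "time \<equiv> lebesgue_on {0..T}"

sublocale time: finite_measure "lebesgue_on {0..T}"
  by (rule finite_measure_lebesgue_on) simp

sublocale P: pair_sigma_finite "lebesgue_on {0..T}" M
  by unfold_locales

lemma time_ident[measurable]: "(\<lambda>t. t) \<in> borel_measurable time"
  using id_borel_measurable_lebesgue_on[of "{0..T}"] by (simp add: id_def)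

lemma section_time: "case_prod f \<in> borel_measurable (time \<Otimes>\<^sub>M M) \<Longrightarrow> \<omega> \<in> space M \<Longrightarrow>
    (\<lambda>t. f t \<omega>) \<in> borel_measurable time"
  using measurable_Pair1[of "case_prod f" time M borel \<omega>] by simp

lemma section_sample: "case_prod f \<in> borel_measurable (time \<Otimes>\<^sub>M M) \<Longrightarrow> t \<in> {0..T} \<Longrightarrow>
    f t \<in> borel_measurable M"
  using measurable_Pair2[of "case_prod f" time M borel t] by simp

definition response :: "(real \<Rightarrow> 'a \<Rightarrow> real) \<Rightarrow> real \<Rightarrow> 'a \<Rightarrow> real" where
  "response f t \<omega> = E t \<omega> * (\<integral>s. (if s \<le> t then f s \<omega> / E s \<omega> else 0) \<partial>time)"

text \<open>
  The sample points at which the pathwise estimates hold and the response is an honest integral;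
  elsewhere a divergent integral has the default value \<open>0\<close> and the response need not be linear.
\<close>

definition tame :: "(real \<Rightarrow> 'a \<Rightarrow> real) \<Rightarrow> 'a \<Rightarrow> bool" where
  "tame f \<omega> \<longleftrightarrow> \<omega> \<in> space M \<and> integrable time (\<lambda>s. f s \<omega>) \<and>
     (\<forall>t\<in>{0..T}. E t \<omega> \<le> S \<omega> \<and> 1 / E t \<omega> \<le> S \<omega>)"

lemma AE_tame:
  assumes "AE \<omega> in M. integrable time (\<lambda>s. f s \<omega>)"
  shows "AE \<omega> in M. tame f \<omega>"
  using assms E_bounds AE_space by eventually_elim (simp add: tame_def)

lemma response_measurable:
  assumes f[measurable]: "case_prod f \<in> borel_measurable (time \<Otimes>\<^sub>M M)"
  shows "(\<lambda>(t, \<omega>). response f t \<omega>) \<in> borel_measurable (time \<Otimes>\<^sub>M M)"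
proof -
  have swap: "(\<lambda>q. (snd q, snd (fst q))) \<in> measurable ((time \<Otimes>\<^sub>M M) \<Otimes>\<^sub>M time) (time \<Otimes>\<^sub>M M)"
    by measurable
  have f': "(\<lambda>q. f (snd q) (snd (fst q))) \<in> borel_measurable ((time \<Otimes>\<^sub>M M) \<Otimes>\<^sub>M time)"
    using measurable_compose[OF swap f] by simp
  have E': "(\<lambda>q. E (snd q) (snd (fst q))) \<in> borel_measurable ((time \<Otimes>\<^sub>M M) \<Otimes>\<^sub>M time)"
    using measurable_compose[OF swap E_measurable] by simp
  have s: "(\<lambda>q. snd q) \<in> borel_measurable ((time \<Otimes>\<^sub>M M) \<Otimes>\<^sub>M time)"
    by (rule measurable_compose[OF measurable_snd time_ident])
  have t: "(\<lambda>q. fst (fst q)) \<in> borel_measurable ((time \<Otimes>\<^sub>M M) \<Otimes>\<^sub>M time)"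
    by (rule measurable_compose[OF measurable_fst measurable_compose[OF measurable_fst time_ident]])
  have "(\<lambda>q. if snd q \<le> fst (fst q) then f (snd q) (snd (fst q)) / E (snd q) (snd (fst q)) else 0)
      \<in> borel_measurable ((time \<Otimes>\<^sub>M M) \<Otimes>\<^sub>M time)"
    by (intro measurable_If borel_measurable_divide f' E' measurable_const borel_measurable_le s t) simp
  then have "(\<lambda>x. \<integral>s. (if s \<le> fst x then f s (snd x) / E s (snd x) else 0) \<partial>time)
      \<in> borel_measurable (time \<Otimes>\<^sub>M M)"
    by (intro time.borel_measurable_lebesgue_integral) (simp add: split_beta')
  moreover have "(\<lambda>x. E (fst x) (snd x)) \<in> borel_measurable (time \<Otimes>\<^sub>M M)"
    using E_measurable by (simp add: split_beta')
  ultimately show ?thesis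
    unfolding response_def split_beta' by (rule borel_measurable_times[rotated])
qed

lemma kernel_integrable:
  assumes "tame f \<omega>"
  shows "integrable time (\<lambda>s. if s \<le> t then f s \<omega> / E s \<omega> else 0)"
proof (rule Bochner_Integration.integrable_bound)
  have \<omega>: "\<omega> \<in> space M" and f: "integrable time (\<lambda>s. f s \<omega>)"
    and bd: "\<And>s. s \<in> {0..T} \<Longrightarrow> 1 / E s \<omega> \<le> S \<omega>"
    using assms by (auto simp: tame_def)
  show "integrable time (\<lambda>s. S \<omega> * f s \<omega>)"
    by (rule integrable_mult_right[OF f])
  have [measurable]: "(\<lambda>s. E s \<omega>) \<in> borel_measurable time"
    by (rule section_time[OF E_measurable \<omega>])
  have [measurable]: "(\<lambda>s. f s \<omega>) \<in> borel_measurable time"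
    using f by simp
  show "(\<lambda>s. if s \<le> t then f s \<omega> / E s \<omega> else 0) \<in> borel_measurable time"
    by measurable
  show "AE s in time. norm (if s \<le> t then f s \<omega> / E s \<omega> else 0) \<le> norm (S \<omega> * f s \<omega>)"
  proof (rule AE_I2)
    fix s assume "s \<in> space time"
    then have "\<bar>f s \<omega>\<bar> * (1 / E s \<omega>) \<le> \<bar>f s \<omega>\<bar> * S \<omega>"
      using bd[of s] by (intro mult_left_mono) auto
    then show "norm (if s \<le> t then f s \<omega> / E s \<omega> else 0) \<le> norm (S \<omega> * f s \<omega>)"
      using E_pos[of s \<omega>] S_ge_1[of \<omega>] by (simp add: abs_mult abs_divide mult.commute)
  qed
qed

lemma response_bound:
  assumes "tame f \<omega>" "t \<in> {0..T}"
  shows "\<bar>response f t \<omega>\<bar> \<le> (S \<omega>)\<^sup>2 * (\<integral>s. \<bar>f s \<omega>\<bar> \<partial>time)"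
proof -
  have f: "integrable time (\<lambda>s. f s \<omega>)"
    and bd: "\<And>s. s \<in> {0..T} \<Longrightarrow> 1 / E s \<omega> \<le> S \<omega>" and Et: "E t \<omega> \<le> S \<omega>"
    using assms by (auto simp: tame_def)
  have "\<bar>\<integral>s. (if s \<le> t then f s \<omega> / E s \<omega> else 0) \<partial>time\<bar>
      \<le> (\<integral>s. \<bar>if s \<le> t then f s \<omega> / E s \<omega> else 0\<bar> \<partial>time)"
    by (rule integral_abs_bound)
  also have "\<dots> \<le> (\<integral>s. S \<omega> * \<bar>f s \<omega>\<bar> \<partial>time)"
  proof (rule integral_mono)
    show "integrable time (\<lambda>s. \<bar>if s \<le> t then f s \<omega> / E s \<omega> else 0\<bar>)"
      by (rule integrable_abs[OF kernel_integrable[OF assms(1)]])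
    show "integrable time (\<lambda>s. S \<omega> * \<bar>f s \<omega>\<bar>)"
      by (rule integrable_mult_right[OF integrable_abs[OF f]])
    fix s assume "s \<in> space time"
    then have "\<bar>f s \<omega>\<bar> * (1 / E s \<omega>) \<le> \<bar>f s \<omega>\<bar> * S \<omega>"
      using bd[of s] by (intro mult_left_mono) auto
    then show "\<bar>if s \<le> t then f s \<omega> / E s \<omega> else 0\<bar> \<le> S \<omega> * \<bar>f s \<omega>\<bar>"
      using E_pos[of s \<omega>] S_ge_1[of \<omega>] by (simp add: abs_mult abs_divide mult.commute)
  qed
  finally have "\<bar>\<integral>s. (if s \<le> t then f s \<omega> / E s \<omega> else 0) \<partial>time\<bar> \<le> S \<omega> * (\<integral>s. \<bar>f s \<omega>\<bar> \<partial>time)"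
    by simp
  then have "E t \<omega> * \<bar>\<integral>s. (if s \<le> t then f s \<omega> / E s \<omega> else 0) \<partial>time\<bar>
      \<le> S \<omega> * (S \<omega> * (\<integral>s. \<bar>f s \<omega>\<bar> \<partial>time))"
    using E_pos[of t \<omega>] S_ge_1[of \<omega>] Et by (intro mult_mono) auto
  then show ?thesis
    using E_pos[of t \<omega>] by (simp add: response_def abs_mult power2_eq_square mult.assoc)
qed

lemma response_diff:
  assumes "tame f \<omega>" "tame g \<omega>"
  shows "response (\<lambda>s \<omega>. f s \<omega> - \<epsilon> * g s \<omega>) t \<omega> = response f t \<omega> - \<epsilon> * response g t \<omega>"
proof -
  have "(\<integral>s. (if s \<le> t then (f s \<omega> - \<epsilon> * g s \<omega>) / E s \<omega> else 0) \<partial>time)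
      = (\<integral>s. (if s \<le> t then f s \<omega> / E s \<omega> else 0) - \<epsilon> * (if s \<le> t then g s \<omega> / E s \<omega> else 0) \<partial>time)"
    by (intro Bochner_Integration.integral_cong) (auto simp: diff_divide_distrib)
  also have "\<dots> = (\<integral>s. (if s \<le> t then f s \<omega> / E s \<omega> else 0) \<partial>time)
      - \<epsilon> * (\<integral>s. (if s \<le> t then g s \<omega> / E s \<omega> else 0) \<partial>time)"
    by (subst Bochner_Integration.integral_diff)
       (simp_all add: kernel_integrable[OF assms(1)] kernel_integrable[OF assms(2)] integrable_mult_right)
  finally show ?thesis
    by (simp only: response_def right_diff_distrib mult.left_commute)
qed

text \<open>
  \<open>F\<close> and its derivative are measurable only on the strip over \<open>[0, T]\<close>, so the substitution has to land
  in the corresponding restricted space.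
\<close>

lemma superposition_measurable:
  assumes G: "(\<lambda>(t, x). G t x) \<in> borel_measurable (restrict_space borel ({0..T} \<times> UNIV))"
    and Y: "(\<lambda>(t, \<omega>). Y t \<omega>) \<in> borel_measurable (time \<Otimes>\<^sub>M M)"
  shows "(\<lambda>(t, \<omega>). G t (Y t \<omega> :: real) :: real) \<in> borel_measurable (time \<Otimes>\<^sub>M M)"
proof -
  have "(\<lambda>q. (fst q, Y (fst q) (snd q))) \<in> measurable (time \<Otimes>\<^sub>M M) (borel \<Otimes>\<^sub>M borel)"
    using Y by (intro measurable_Pair measurable_compose[OF measurable_fst time_ident])
      (simp add: split_beta')
  then have "(\<lambda>q. (fst q, Y (fst q) (snd q)))
      \<in> measurable (time \<Otimes>\<^sub>M M) (restrict_space borel ({0..T} \<times> UNIV))"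
    unfolding borel_prod by (intro measurable_restrict_space2) (auto simp: space_pair_measure)
  from measurable_compose[OF this G] show ?thesis
    by (simp add: split_beta')
qed

text \<open>
  Unit mass just after \<open>t\<^sub>0\<close>.  The interval is open on the left, so that the response vanishes at all
  \<open>t \<le> t\<^sub>0\<close>; it may reach beyond \<open>T\<close>, where the mass is lost.
\<close>

definition needle :: "real \<Rightarrow> nat \<Rightarrow> real \<Rightarrow> real" where
  "needle t\<^sub>0 n s = real (Suc n) * indicator {t\<^sub>0<..t\<^sub>0 + 1 / real (Suc n)} s"

lemma needle_integrable: "integrable time (needle t\<^sub>0 n)"
proof -
  have "(\<lambda>s. indicator {t\<^sub>0<..t\<^sub>0 + 1 / real (Suc n)} s :: real) \<in> borel_measurable time"
    by measurable
  then have "integrable time (\<lambda>s. indicator {t\<^sub>0<..t\<^sub>0 + 1 / real (Suc n)} s :: real)"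
    by (rule time.integrable_const_bound[where B = 1, rotated]) (auto split: split_indicator)
  then show ?thesis
    unfolding needle_def by (rule integrable_mult_right)
qed

lemma needle_integral:
  shows "(\<integral>s. needle t\<^sub>0 n s \<partial>time) \<le> 1"
    and "\<lbrakk>0 \<le> t\<^sub>0; t\<^sub>0 + 1 / real (Suc n) \<le> T\<rbrakk> \<Longrightarrow> (\<integral>s. needle t\<^sub>0 n s \<partial>time) = 1"
proof -
  let ?I = "{t\<^sub>0<..t\<^sub>0 + 1 / real (Suc n)}"
  have I: "measure lebesgue ?I = 1 / real (Suc n)"
    by simp
  have eq: "(\<integral>s. needle t\<^sub>0 n s \<partial>time) = real (Suc n) * measure lebesgue ({0..T} \<inter> ?I)"
    unfolding needle_def by (simp add: measure_restrict_space Int_commute del: of_nat_Suc)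
  have "measure lebesgue ({0..T} \<inter> ?I) \<le> measure lebesgue ?I"
    by (intro measure_mono_fmeasurable) (auto simp: fmeasurable_def)
  then have "real (Suc n) * measure lebesgue ({0..T} \<inter> ?I) \<le> real (Suc n) * (1 / real (Suc n))"
    unfolding I by (rule mult_left_mono) simp
  then show "(\<integral>s. needle t\<^sub>0 n s \<partial>time) \<le> 1"
    unfolding eq by (simp del: of_nat_Suc)
  assume "0 \<le> t\<^sub>0" "t\<^sub>0 + 1 / real (Suc n) \<le> T"
  then have "{0..T} \<inter> ?I = ?I" by auto
  then show "(\<integral>s. needle t\<^sub>0 n s \<partial>time) = 1"
    unfolding eq using I by (simp del: of_nat_Suc)
qed

lemma needle_nonneg: "0 \<le> needle t\<^sub>0 n s"
  by (simp add: needle_def)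

lemma needle_average:
  fixes g :: "real \<Rightarrow> real"
  assumes g: "continuous_on {0..T} g" and t\<^sub>0: "0 \<le> t\<^sub>0" "t\<^sub>0 < T"
  shows "(\<lambda>n. \<integral>s. needle t\<^sub>0 n s * g s \<partial>time) \<longlonglongrightarrow> g t\<^sub>0"
proof (rule LIMSEQ_I)
  fix e :: real assume e: "0 < e"
  obtain d where d: "0 < d" "\<And>s. s \<in> {0..T} \<Longrightarrow> dist s t\<^sub>0 < d \<Longrightarrow> dist (g s) (g t\<^sub>0) < e / 2"
    using g t\<^sub>0 e unfolding continuous_on_iff by (metis atLeastAtMost_iff half_gt_zero less_eq_real_def)
  obtain N where N: "1 / real (Suc N) < min d (T - t\<^sub>0)"
    using nat_approx_posE[of "min d (T - t\<^sub>0)"] d t\<^sub>0 by auto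
  have "bounded (g ` {0..T})"
    using compact_imp_bounded[OF compact_continuous_image[OF g]] by simp
  then obtain B where B: "\<And>s. s \<in> {0..T} \<Longrightarrow> \<bar>g s\<bar> \<le> B"
    unfolding bounded_iff by (metis imageI real_norm_def)
  have g_meas[measurable]: "g \<in> borel_measurable time"
    using g by (simp add: continuous_imp_measurable_on_sets_lebesgue)
  have "norm ((\<integral>s. needle t\<^sub>0 n s * g s \<partial>time) - g t\<^sub>0) < e" if "N \<le> n" for n
  proof -
    have "1 / real (Suc n) \<le> 1 / real (Suc N)"
      using that by (intro divide_left_mono) auto
    then have n: "1 / real (Suc n) < d" "t\<^sub>0 + 1 / real (Suc n) \<le> T"
      using N by auto
    have int1: "integrable time (\<lambda>s. needle t\<^sub>0 n s * g s)"
    proof (rule Bochner_Integration.integrable_bound)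
      show "integrable time (\<lambda>s. needle t\<^sub>0 n s * B)"
        by (intro integrable_mult_left needle_integrable)
      show "(\<lambda>s. needle t\<^sub>0 n s * g s) \<in> borel_measurable time"
        using needle_integrable[of t\<^sub>0 n] by (intro borel_measurable_times g_meas) auto
      show "AE s in time. norm (needle t\<^sub>0 n s * g s) \<le> norm (needle t\<^sub>0 n s * B)"
        using B by (intro AE_I2) (auto simp: abs_mult intro!: mult_left_mono intro: order_trans[OF _ abs_ge_self])
    qed
    have int2: "integrable time (\<lambda>s. needle t\<^sub>0 n s * g t\<^sub>0)"
      by (intro integrable_mult_left needle_integrable)
    have "(\<integral>s. needle t\<^sub>0 n s * g s \<partial>time) - g t\<^sub>0
        = (\<integral>s. needle t\<^sub>0 n s * g s \<partial>time) - (\<integral>s. needle t\<^sub>0 n s * g t\<^sub>0 \<partial>time)"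
      using needle_integral(2)[OF t\<^sub>0(1) n(2)] by simp
    also have "\<dots> = (\<integral>s. needle t\<^sub>0 n s * g s - needle t\<^sub>0 n s * g t\<^sub>0 \<partial>time)"
      by (rule Bochner_Integration.integral_diff[OF int1 int2, symmetric])
    also have "\<bar>\<dots>\<bar> \<le> (\<integral>s. \<bar>needle t\<^sub>0 n s * g s - needle t\<^sub>0 n s * g t\<^sub>0\<bar> \<partial>time)"
      by (rule integral_abs_bound)
    also have "\<dots> \<le> (\<integral>s. needle t\<^sub>0 n s * (e / 2) \<partial>time)"
    proof (rule integral_mono)
      show "integrable time (\<lambda>s. \<bar>needle t\<^sub>0 n s * g s - needle t\<^sub>0 n s * g t\<^sub>0\<bar>)"
        by (intro integrable_abs Bochner_Integration.integrable_diff int1 int2)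
      show "integrable time (\<lambda>s. needle t\<^sub>0 n s * (e / 2))"
        by (intro integrable_mult_left needle_integrable)
      fix s assume s: "s \<in> space time"
      show "\<bar>needle t\<^sub>0 n s * g s - needle t\<^sub>0 n s * g t\<^sub>0\<bar> \<le> needle t\<^sub>0 n s * (e / 2)"
      proof (cases "s \<in> {t\<^sub>0<..t\<^sub>0 + 1 / real (Suc n)}")
        case True
        then have "dist s t\<^sub>0 < d" using n by (auto simp: dist_real_def)
        then have "\<bar>g s - g t\<^sub>0\<bar> \<le> e / 2"
          using d(2)[of s] s by (simp add: dist_real_def)
        then have "needle t\<^sub>0 n s * \<bar>g s - g t\<^sub>0\<bar> \<le> needle t\<^sub>0 n s * (e / 2)"
          by (rule mult_left_mono) (rule needle_nonneg)
        then show ?thesis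
          using needle_nonneg[of t\<^sub>0 n s] by (simp add: abs_mult flip: right_diff_distrib)
      next
        case False
        then show ?thesis by (simp add: needle_def)
      qed
    qed
    also have "\<dots> = e / 2"
      using needle_integral(2)[OF t\<^sub>0(1) n(2)] by simp
    finally show ?thesis using e by simp
  qed
  then show "\<exists>N. \<forall>n\<ge>N. norm ((\<integral>s. needle t\<^sub>0 n s * g s \<partial>time) - g t\<^sub>0) < e"
    by blast
qed

lemma response_needle_tendsto:
  assumes \<omega>: "\<omega> \<in> space M" and t: "t \<in> {0..T}" and t\<^sub>0: "t\<^sub>0 \<in> {0..T}"
  shows "(\<lambda>n. response (\<lambda>s _. needle t\<^sub>0 n s) t \<omega>) \<longlonglongrightarrow> (if t\<^sub>0 < t then E t \<omega> / E t\<^sub>0 \<omega> else 0)"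
proof (cases "t\<^sub>0 < t")
  case False
  have "(if s \<le> t then needle t\<^sub>0 n s / E s \<omega> else 0) = 0" for n s
    using False by (simp add: needle_def)
  then show ?thesis
    using False by (simp add: response_def)
next
  case True
  have "continuous_on {0..T} (\<lambda>s. 1 / E s \<omega>)"
    using E_pos[of _ \<omega>] by (intro continuous_on_divide continuous_on_const E_continuous[OF \<omega>]) (metis less_irrefl)
  then have "(\<lambda>n. E t \<omega> * (\<integral>s. needle t\<^sub>0 n s * (1 / E s \<omega>) \<partial>time)) \<longlonglongrightarrow> E t \<omega> * (1 / E t\<^sub>0 \<omega>)"
    using t t\<^sub>0 True by (intro tendsto_mult tendsto_const needle_average) auto
  moreover have "\<forall>\<^sub>F n in sequentially.
      E t \<omega> * (\<integral>s. needle t\<^sub>0 n s * (1 / E s \<omega>) \<partial>time) = response (\<lambda>s _. needle t\<^sub>0 n s) t \<omega>"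
  proof -
    obtain N where N: "1 / real (Suc N) < t - t\<^sub>0"
      using nat_approx_posE[of "t - t\<^sub>0"] True by auto
    show ?thesis
    proof (rule eventually_sequentiallyI[of N])
      fix n assume "N \<le> n"
      then have "1 / real (Suc n) \<le> 1 / real (Suc N)"
        by (intro divide_left_mono) auto
      then have "needle t\<^sub>0 n s * (1 / E s \<omega>) = (if s \<le> t then needle t\<^sub>0 n s / E s \<omega> else 0)" for s
        using N by (auto simp: needle_def split: split_indicator)
      then show "E t \<omega> * (\<integral>s. needle t\<^sub>0 n s * (1 / E s \<omega>) \<partial>time) = response (\<lambda>s _. needle t\<^sub>0 n s) t \<omega>"
        by (simp add: response_def)
    qed
  qed
  ultimately show ?thesis
    using True by (simp add: tendsto_cong)
qed

end

section \<open>Vanishing first variation\<close>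

text \<open>
  The control is deterministic while the forcing \<open>z\<close> is random, so the state is the response to \<open>z - u\<close>.
  In \<open>moment\<close>, two powers of \<open>S\<close> come from the kernel \<open>E t / E s\<close> in the variation of the state, and the
  other \<open>2 \<alpha>\<close> from the same kernel in the state itself, raised to the power \<open>\<alpha>\<close> by the growth condition.
\<close>

locale control_problem = random_flow M T E S
  for M :: "'a measure" and T :: real and E :: "real \<Rightarrow> 'a \<Rightarrow> real" and S :: "'a \<Rightarrow> real" +
  fixes z :: "real \<Rightarrow> 'a \<Rightarrow> real" and u L :: "real \<Rightarrow> real" and F F\<^sub>1 :: "real \<Rightarrow> real \<Rightarrow> real"
    and \<alpha> :: real
  assumes z_measurable: "case_prod z \<in> borel_measurable (lebesgue_on {0..T} \<Otimes>\<^sub>M M)"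
    and z_integrable: "AE \<omega> in M. integrable (lebesgue_on {0..T}) (\<lambda>s. z s \<omega>)"
    and u_integrable: "integrable (lebesgue_on {0..T}) u"
    and \<alpha>_pos: "0 < \<alpha>"
    and F_measurable: "(\<lambda>(t, x). F t x) \<in> borel_measurable (restrict_space borel ({0..T} \<times> UNIV))"
    and F_nonneg: "\<And>t x. t \<in> {0..T} \<Longrightarrow> 0 \<le> F t x"
    and F_deriv: "\<And>t x. t \<in> {0..T} \<Longrightarrow> (F t has_real_derivative F\<^sub>1 t x) (at x)"
    and F\<^sub>1_continuous: "continuous_on ({0..T} \<times> UNIV) (\<lambda>(t, x). F\<^sub>1 t x)"
    and L_integrable: "integrable (lebesgue_on {0..T}) L"
    and L_nonneg: "\<And>t. t \<in> {0..T} \<Longrightarrow> 0 \<le> L t"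
    and growth: "\<And>t x. t \<in> {0..T} \<Longrightarrow> \<bar>F t x\<bar> + \<bar>F\<^sub>1 t x\<bar> \<le> L t * (1 + \<bar>x\<bar> powr \<alpha>)"
    and moment: "\<And>c. 0 \<le> c \<Longrightarrow> integrable M
        (\<lambda>\<omega>. S \<omega> powr (2 + 2 * \<alpha>) * (c + (\<integral>s. \<bar>z s \<omega>\<bar> \<partial>lebesgue_on {0..T})) powr \<alpha>)"
    and minimal: "\<And>v. integrable (lebesgue_on {0..T}) v \<Longrightarrow>
        (\<integral>\<^sup>+\<omega>. (\<integral>\<^sup>+t. ennreal (F t (response (\<lambda>s \<omega>. z s \<omega> - u s) t \<omega>)) \<partial>lebesgue_on {0..T}) \<partial>M)
        \<le> (\<integral>\<^sup>+\<omega>. (\<integral>\<^sup>+t. ennreal (F t (response (\<lambda>s \<omega>. z s \<omega> - v s) t \<omega>)) \<partial>lebesgue_on {0..T}) \<partial>M)"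
begin

definition X :: "real \<Rightarrow> 'a \<Rightarrow> real" where
  "X t \<omega> = response (\<lambda>s \<omega>. z s \<omega> - u s) t \<omega>"

text \<open>
  The summand \<open>1\<close> leaves room for the response to a perturbation of mass at most \<open>1\<close>, and makes
  \<open>S\<^sup>2 \<zeta>\<close> at least \<open>1\<close>, so that \<open>1 + (S\<^sup>2 \<zeta>) powr \<alpha>\<close> is at most twice its second summand.
\<close>

definition \<zeta> :: "'a \<Rightarrow> real" where
  "\<zeta> \<omega> = (\<integral>s. \<bar>u s\<bar> \<partial>time) + 1 + (\<integral>s. \<bar>z s \<omega>\<bar> \<partial>time)"

definition \<Psi> :: "'a \<Rightarrow> real" where
  "\<Psi> \<omega> = 2 * (S \<omega> powr (2 + 2 * \<alpha>) * \<zeta> \<omega> powr \<alpha>)"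

lemma \<zeta>_ge_1: "1 \<le> \<zeta> \<omega>"
  by (simp add: \<zeta>_def)

lemma \<Psi>_integrable: "integrable M \<Psi>"
  unfolding \<Psi>_def \<zeta>_def by (intro integrable_mult_right moment) simp

lemma dominating_integrable: "integrable (time \<Otimes>\<^sub>M M) (\<lambda>q. L (fst q) * \<Psi> (snd q))"
  by (rule P.integrable_product_real[OF L_integrable \<Psi>_integrable])

text \<open>
  The factor \<open>S\<^sup>2\<close> is the bound for the response that multiplies \<open>F\<^sub>1\<close> in the first variation; it also
  dominates the kernel \<open>E t / E s\<close>.
\<close>

lemma growth_bound:
  assumes t: "t \<in> {0..T}" and x: "\<bar>x\<bar> \<le> (S \<omega>)\<^sup>2 * \<zeta> \<omega>"
  shows "(\<bar>F t x\<bar> + \<bar>F\<^sub>1 t x\<bar>) * (S \<omega>)\<^sup>2 \<le> L t * \<Psi> \<omega>"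
proof -
  let ?y = "(S \<omega>)\<^sup>2 * \<zeta> \<omega>"
  have S: "0 < S \<omega>" "1 \<le> (S \<omega>)\<^sup>2"
    using S_ge_1[of \<omega>] by auto
  have y: "1 \<le> ?y"
    using mult_mono[OF S(2) \<zeta>_ge_1[of \<omega>]] \<zeta>_ge_1[of \<omega>] by simp
  have "\<bar>x\<bar> powr \<alpha> \<le> ?y powr \<alpha>"
    using x \<alpha>_pos by (intro powr_mono2) auto
  moreover have "1 \<le> ?y powr \<alpha>"
    using y \<alpha>_pos by (intro ge_one_powr_ge_zero) auto
  ultimately have "1 + \<bar>x\<bar> powr \<alpha> \<le> 2 * ?y powr \<alpha>"
    by simp
  then have "L t * (1 + \<bar>x\<bar> powr \<alpha>) \<le> L t * (2 * ?y powr \<alpha>)"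
    by (rule mult_left_mono) (rule L_nonneg[OF t])
  with growth[OF t, of x] have "\<bar>F t x\<bar> + \<bar>F\<^sub>1 t x\<bar> \<le> L t * (2 * ?y powr \<alpha>)"
    by linarith
  then have "(\<bar>F t x\<bar> + \<bar>F\<^sub>1 t x\<bar>) * (S \<omega>)\<^sup>2 \<le> L t * (2 * ?y powr \<alpha>) * (S \<omega>)\<^sup>2"
    by (rule mult_right_mono) simp
  also have "\<dots> = L t * \<Psi> \<omega>"
  proof -
    have sq: "(S \<omega>)\<^sup>2 = S \<omega> powr 2"
      using S by simp
    have "?y powr \<alpha> = S \<omega> powr (2 * \<alpha>) * \<zeta> \<omega> powr \<alpha>"
      unfolding sq using \<zeta>_ge_1[of \<omega>] by (simp add: powr_mult powr_powr)
    then show ?thesis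
      unfolding \<Psi>_def sq powr_add by (simp add: mult_ac)
  qed
  finally show ?thesis .
qed

lemma forcing_measurable: "integrable time v \<Longrightarrow> (\<lambda>(s, \<omega>). z s \<omega> - v s) \<in> borel_measurable (time \<Otimes>\<^sub>M M)"
  using z_measurable measurable_compose[OF measurable_fst borel_measurable_integrable, of time v M]
  by (simp add: split_beta' borel_measurable_diff)

lemma X_measurable: "(\<lambda>(t, \<omega>). X t \<omega>) \<in> borel_measurable (time \<Otimes>\<^sub>M M)"
  unfolding X_def by (rule response_measurable[OF forcing_measurable[OF u_integrable]])

lemma F\<^sub>1_measurable: "(\<lambda>(t, x). F\<^sub>1 t x) \<in> borel_measurable (restrict_space borel ({0..T} \<times> UNIV))"
  by (rule borel_measurable_continuous_on_restrict[OF F\<^sub>1_continuous])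

lemma AE_tame_forcing: "AE \<omega> in M. tame (\<lambda>s \<omega>. z s \<omega> - u s) \<omega> \<and> \<bar>\<integral>s. \<bar>z s \<omega> - u s\<bar> \<partial>time\<bar> \<le> \<zeta> \<omega> - 1"
proof -
  have "AE \<omega> in M. integrable time (\<lambda>s. z s \<omega> - u s)"
    using z_integrable by eventually_elim (rule Bochner_Integration.integrable_diff[OF _ u_integrable])
  from AE_tame[OF this] z_integrable show ?thesis
  proof eventually_elim
    case (elim \<omega>)
    have "(\<integral>s. \<bar>z s \<omega> - u s\<bar> \<partial>time) \<le> (\<integral>s. \<bar>z s \<omega>\<bar> + \<bar>u s\<bar> \<partial>time)"
      by (rule integral_mono[OF integrable_abs[OF Bochner_Integration.integrable_diff[OF elim(2) u_integrable]]
            Bochner_Integration.integrable_add[OF integrable_abs[OF elim(2)] integrable_abs[OF u_integrable]]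
            abs_triangle_ineq4])
    also have "\<dots> = (\<integral>s. \<bar>z s \<omega>\<bar> \<partial>time) + (\<integral>s. \<bar>u s\<bar> \<partial>time)"
      by (rule Bochner_Integration.integral_add[OF integrable_abs[OF elim(2)] integrable_abs[OF u_integrable]])
    finally have "\<bar>\<integral>s. \<bar>z s \<omega> - u s\<bar> \<partial>time\<bar> \<le> \<zeta> \<omega> - 1"
      by (simp add: \<zeta>_def)
    with elim show ?case by blast
  qed
qed

lemma AE_state_bound: "AE \<omega> in M. \<forall>t\<in>{0..T}. \<bar>X t \<omega>\<bar> \<le> (S \<omega>)\<^sup>2 * (\<zeta> \<omega> - 1)"
  using AE_tame_forcing
proof eventually_elim
  case (elim \<omega>)
  show ?case
  proof
    fix t assume "t \<in> {0..T}"
    then have "\<bar>X t \<omega>\<bar> \<le> (S \<omega>)\<^sup>2 * (\<integral>s. \<bar>z s \<omega> - u s\<bar> \<partial>time)"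
      unfolding X_def using elim by (intro response_bound) auto
    also have "\<dots> \<le> (S \<omega>)\<^sup>2 * (\<zeta> \<omega> - 1)"
      using elim by (intro mult_left_mono) auto
    finally show "\<bar>X t \<omega>\<bar> \<le> (S \<omega>)\<^sup>2 * (\<zeta> \<omega> - 1)" .
  qed
qed

lemma AE_tame_deterministic: "integrable time v \<Longrightarrow> AE \<omega> in M. tame (\<lambda>s _. v s) \<omega>"
  by (rule AE_tame) simp

lemma AE_response_le_square:
  assumes v: "integrable time v" "(\<integral>s. \<bar>v s\<bar> \<partial>time) \<le> 1"
  shows "AE \<omega> in M. \<forall>t\<in>{0..T}. \<bar>response (\<lambda>s _. v s) t \<omega>\<bar> \<le> (S \<omega>)\<^sup>2"
  using AE_tame_deterministic[OF v(1)]
proof eventually_elim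
  case (elim \<omega>)
  show ?case
  proof
    fix t assume "t \<in> {0..T}"
    from response_bound[OF elim this]
    have "\<bar>response (\<lambda>s _. v s) t \<omega>\<bar> \<le> (S \<omega>)\<^sup>2 * (\<integral>s. \<bar>v s\<bar> \<partial>time)" .
    also have "\<dots> \<le> (S \<omega>)\<^sup>2"
      using mult_left_mono[OF v(2), of "(S \<omega>)\<^sup>2"] by simp
    finally show "\<bar>response (\<lambda>s _. v s) t \<omega>\<bar> \<le> (S \<omega>)\<^sup>2" .
  qed
qed

lemma deterministic_response_measurable:
  assumes "integrable time v"
  shows "(\<lambda>(t, \<omega>). response (\<lambda>s _. v s) t \<omega>) \<in> borel_measurable (time \<Otimes>\<^sub>M M)"
  using measurable_compose[OF measurable_fst borel_measurable_integrable[OF assms], of M]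
  by (intro response_measurable) (simp add: split_beta')

text \<open>
  Fermat's rule at the minimizing control in direction \<open>v\<close>.  Only the response to \<open>v\<close> is scaled, by
  linearity, and the majorant \<open>L * \<Psi>\<close> serves for all \<open>\<epsilon>\<close> between \<open>-1\<close> and \<open>1\<close>.
\<close>

lemma first_variation:
  assumes v: "integrable time v" "(\<integral>s. \<bar>v s\<bar> \<partial>time) \<le> 1"
  shows "(\<integral>q. F\<^sub>1 (fst q) (X (fst q) (snd q)) * response (\<lambda>s _. v s) (fst q) (snd q) \<partial>(time \<Otimes>\<^sub>M M)) = 0"
proof -
  define R where "R = response (\<lambda>s _. v s)"
  define \<Phi> where "\<Phi> q \<epsilon> = F (fst q) (X (fst q) (snd q) - \<epsilon> * R (fst q) (snd q))" for q \<epsilon>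
  define \<Phi>' where "\<Phi>' q \<epsilon> = F\<^sub>1 (fst q) (X (fst q) (snd q) - \<epsilon> * R (fst q) (snd q)) * - R (fst q) (snd q)" for q \<epsilon>
  have R_meas: "(\<lambda>(t, \<omega>). R t \<omega>) \<in> borel_measurable (time \<Otimes>\<^sub>M M)"
    unfolding R_def by (rule deterministic_response_measurable[OF v(1)])
  have shift: "(\<lambda>(t, \<omega>). X t \<omega> - \<epsilon> * R t \<omega>) \<in> borel_measurable (time \<Otimes>\<^sub>M M)" for \<epsilon>
    using X_measurable R_meas by (simp add: split_beta')
  have \<Phi>_meas: "(\<lambda>q. \<Phi> q \<epsilon>) \<in> borel_measurable (time \<Otimes>\<^sub>M M)" for \<epsilon>
    using superposition_measurable[OF F_measurable shift[of \<epsilon>]] by (simp add: \<Phi>_def split_beta')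
  have "(\<lambda>q. F\<^sub>1 (fst q) (X (fst q) (snd q) - 0 * R (fst q) (snd q))) \<in> borel_measurable (time \<Otimes>\<^sub>M M)"
    using superposition_measurable[OF F\<^sub>1_measurable shift[of 0]] by (simp add: split_beta')
  then have \<Phi>'_meas: "(\<lambda>q. \<Phi>' q 0) \<in> borel_measurable (time \<Otimes>\<^sub>M M)"
    unfolding \<Phi>'_def using R_meas by (intro borel_measurable_times borel_measurable_uminus) (simp_all add: split_beta')
  have "AE \<omega> in M. \<forall>t\<in>{0..T}. \<forall>\<epsilon>\<in>{-1..1}. \<bar>\<Phi>' (t, \<omega>) \<epsilon>\<bar> \<le> L t * \<Psi> \<omega> \<and> \<bar>\<Phi> (t, \<omega>) 0\<bar> \<le> L t * \<Psi> \<omega>"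
    using AE_state_bound AE_response_le_square[OF v]
  proof eventually_elim
    case (elim \<omega>)
    show ?case
    proof (intro ballI conjI)
      fix t \<epsilon> :: real assume t: "t \<in> {0..T}" and \<epsilon>: "\<epsilon> \<in> {-1..1}"
      have R: "\<bar>R t \<omega>\<bar> \<le> (S \<omega>)\<^sup>2" and X: "\<bar>X t \<omega>\<bar> \<le> (S \<omega>)\<^sup>2 * \<zeta> \<omega> - (S \<omega>)\<^sup>2"
        using elim t by (auto simp: R_def right_diff_distrib)
      have "\<bar>\<epsilon> * R t \<omega>\<bar> \<le> 1 * (S \<omega>)\<^sup>2"
        unfolding abs_mult using R \<epsilon> by (intro mult_mono) auto
      then have "\<bar>X t \<omega> - \<epsilon> * R t \<omega>\<bar> \<le> (S \<omega>)\<^sup>2 * \<zeta> \<omega>"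
        using X by linarith
      note b = growth_bound[OF t this]
      have "\<bar>\<Phi>' (t, \<omega>) \<epsilon>\<bar> \<le> \<bar>F\<^sub>1 t (X t \<omega> - \<epsilon> * R t \<omega>)\<bar> * (S \<omega>)\<^sup>2"
        unfolding \<Phi>'_def using R by (simp add: abs_mult mult_left_mono)
      also have "\<dots> \<le> (\<bar>F t (X t \<omega> - \<epsilon> * R t \<omega>)\<bar> + \<bar>F\<^sub>1 t (X t \<omega> - \<epsilon> * R t \<omega>)\<bar>) * (S \<omega>)\<^sup>2"
        by (intro mult_right_mono) auto
      finally show "\<bar>\<Phi>' (t, \<omega>) \<epsilon>\<bar> \<le> L t * \<Psi> \<omega>"
        using b by linarith
      have "\<bar>X t \<omega>\<bar> \<le> (S \<omega>)\<^sup>2 * \<zeta> \<omega>"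
        using X zero_le_power2[of "S \<omega>"] by linarith
      note b = growth_bound[OF t this]
      have "\<bar>F t (X t \<omega>)\<bar> * 1 \<le> (\<bar>F t (X t \<omega>)\<bar> + \<bar>F\<^sub>1 t (X t \<omega>)\<bar>) * (S \<omega>)\<^sup>2"
        using S_ge_1[of \<omega>] by (intro mult_mono) auto
      with b show "\<bar>\<Phi> (t, \<omega>) 0\<bar> \<le> L t * \<Psi> \<omega>"
        by (simp add: \<Phi>_def)
    qed
  qed
  from P.AE_snd_imp_AE_pair[OF this] AE_space
  have bounds: "AE q in time \<Otimes>\<^sub>M M. (\<forall>\<epsilon>\<in>{-1..1}. \<bar>\<Phi>' q \<epsilon>\<bar> \<le> L (fst q) * \<Psi> (snd q)) \<and>
      \<bar>\<Phi> q 0\<bar> \<le> L (fst q) * \<Psi> (snd q)"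
  proof eventually_elim
    case (elim q)
    then have "fst q \<in> {0..T}" by (auto simp: space_pair_measure)
    from bspec[OF elim(1) this] have *: "\<forall>\<epsilon>\<in>{-1..1}. \<bar>\<Phi>' q \<epsilon>\<bar> \<le> L (fst q) * \<Psi> (snd q) \<and> \<bar>\<Phi> q 0\<bar> \<le> L (fst q) * \<Psi> (snd q)"
      by simp
    then have "\<bar>\<Phi> q 0\<bar> \<le> L (fst q) * \<Psi> (snd q)" by (meson atLeastAtMost_iff neg_le_0_iff_le zero_le_one)
    with * show ?case by blast
  qed
  have \<Phi>_int: "integrable (time \<Otimes>\<^sub>M M) (\<lambda>q. \<Phi> q 0)"
  proof (rule Bochner_Integration.integrable_bound[OF dominating_integrable \<Phi>_meas])
    show "AE q in time \<Otimes>\<^sub>M M. norm (\<Phi> q 0) \<le> norm (L (fst q) * \<Psi> (snd q))"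
      using bounds by eventually_elim (auto intro: order_trans[OF _ abs_ge_self])
  qed
  have cost_\<Phi>: "(\<integral>\<^sup>+q. ennreal (\<Phi> q \<epsilon>) \<partial>(time \<Otimes>\<^sub>M M))
      = (\<integral>\<^sup>+\<omega>. (\<integral>\<^sup>+t. ennreal (F t (response (\<lambda>s \<omega>. z s \<omega> - (u s + \<epsilon> * v s)) t \<omega>)) \<partial>time) \<partial>M)" for \<epsilon>
  proof -
    have "(\<integral>\<^sup>+q. ennreal (\<Phi> q \<epsilon>) \<partial>(time \<Otimes>\<^sub>M M)) = (\<integral>\<^sup>+\<omega>. (\<integral>\<^sup>+t. ennreal (\<Phi> (t, \<omega>) \<epsilon>) \<partial>time) \<partial>M)"
      by (rule P.nn_integral_snd[symmetric]) (rule measurable_compose[OF \<Phi>_meas measurable_ennreal])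
    also have "\<dots> = (\<integral>\<^sup>+\<omega>. (\<integral>\<^sup>+t. ennreal (F t (response (\<lambda>s \<omega>. z s \<omega> - (u s + \<epsilon> * v s)) t \<omega>)) \<partial>time) \<partial>M)"
    proof (rule nn_integral_cong_AE)
      show "AE \<omega> in M. (\<integral>\<^sup>+t. ennreal (\<Phi> (t, \<omega>) \<epsilon>) \<partial>time)
          = (\<integral>\<^sup>+t. ennreal (F t (response (\<lambda>s \<omega>. z s \<omega> - (u s + \<epsilon> * v s)) t \<omega>)) \<partial>time)"
        using AE_tame_forcing AE_tame_deterministic[OF v(1)]
      proof eventually_elim
        case (elim \<omega>)
        have "X t \<omega> - \<epsilon> * R t \<omega> = response (\<lambda>s \<omega>. z s \<omega> - (u s + \<epsilon> * v s)) t \<omega>" for t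
          using response_diff[of "\<lambda>s \<omega>. z s \<omega> - u s" \<omega> "\<lambda>s _. v s" \<epsilon> t] elim
          by (simp add: X_def R_def diff_diff_eq)
        then show ?case by (simp add: \<Phi>_def)
      qed
    qed
    finally show ?thesis .
  qed
  have "(\<integral>q. \<Phi>' q 0 \<partial>(time \<Otimes>\<^sub>M M)) = 0"
  proof (rule first_variation_eq_zero[where \<Phi> = \<Phi> and \<Phi>' = \<Phi>', OF \<Phi>_meas \<Phi>'_meas _ _ _ dominating_integrable \<Phi>_int])
    fix q \<epsilon> assume "q \<in> space (time \<Otimes>\<^sub>M M)"
    then have q: "fst q \<in> {0..T}" by (auto simp: space_pair_measure)
    then show "0 \<le> \<Phi> q \<epsilon>" by (simp add: \<Phi>_def F_nonneg)
    show "(\<Phi> q has_real_derivative \<Phi>' q \<epsilon>) (at \<epsilon>)"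
      unfolding \<Phi>_def \<Phi>'_def
      by (rule DERIV_chain2[OF F_deriv[OF q]]) (auto intro!: derivative_eq_intros)
  next
    show "AE q in time \<Otimes>\<^sub>M M. \<forall>\<epsilon>\<in>{-1..1}. \<bar>\<Phi>' q \<epsilon>\<bar> \<le> L (fst q) * \<Psi> (snd q)"
      using bounds by eventually_elim blast
  next
    fix \<epsilon>
    show "(\<integral>\<^sup>+q. ennreal (\<Phi> q 0) \<partial>(time \<Otimes>\<^sub>M M)) \<le> (\<integral>\<^sup>+q. ennreal (\<Phi> q \<epsilon>) \<partial>(time \<Otimes>\<^sub>M M))"
      unfolding cost_\<Phi> using minimal[of "\<lambda>s. u s + \<epsilon> * v s"] u_integrable v(1) by simp
  qed
  then show ?thesis
    by (simp add: \<Phi>'_def R_def)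
qed

lemma adjoint_integrable:
  assumes t: "t \<in> {0..T}" and s: "s \<in> {0..T}"
  shows "integrable M (\<lambda>\<omega>. F\<^sub>1 t (X t \<omega>) * (E t \<omega> / E s \<omega>))"
proof (rule Bochner_Integration.integrable_bound)
  show "integrable M (\<lambda>\<omega>. L t * \<Psi> \<omega>)"
    by (rule integrable_mult_right[OF \<Psi>_integrable])
  have "(\<lambda>\<omega>. F\<^sub>1 t (X t \<omega>)) \<in> borel_measurable M"
    using section_sample[OF superposition_measurable[OF F\<^sub>1_measurable X_measurable] t] .
  then show "(\<lambda>\<omega>. F\<^sub>1 t (X t \<omega>) * (E t \<omega> / E s \<omega>)) \<in> borel_measurable M"
    using section_sample[OF E_measurable t] section_sample[OF E_measurable s]
    by (intro borel_measurable_times borel_measurable_divide)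
  show "AE \<omega> in M. norm (F\<^sub>1 t (X t \<omega>) * (E t \<omega> / E s \<omega>)) \<le> norm (L t * \<Psi> \<omega>)"
    using AE_state_bound E_bounds
  proof eventually_elim
    case (elim \<omega>)
    have "\<bar>X t \<omega>\<bar> \<le> (S \<omega>)\<^sup>2 * \<zeta> \<omega> - (S \<omega>)\<^sup>2"
      using elim(1) t by (auto simp: right_diff_distrib)
    then have "\<bar>X t \<omega>\<bar> \<le> (S \<omega>)\<^sup>2 * \<zeta> \<omega>"
      using zero_le_power2[of "S \<omega>"] by linarith
    note b = growth_bound[OF t this]
    have "E t \<omega> * (1 / E s \<omega>) \<le> S \<omega> * S \<omega>"
      using elim(2) t s E_pos[of t \<omega>] E_pos[of s \<omega>] S_ge_1[of \<omega>] by (intro mult_mono) auto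
    then have "\<bar>F\<^sub>1 t (X t \<omega>)\<bar> * (E t \<omega> / E s \<omega>) \<le> (\<bar>F t (X t \<omega>)\<bar> + \<bar>F\<^sub>1 t (X t \<omega>)\<bar>) * (S \<omega>)\<^sup>2"
      using E_pos[of t \<omega>] E_pos[of s \<omega>] by (intro mult_mono) (auto simp: power2_eq_square)
    with b have "\<bar>F\<^sub>1 t (X t \<omega>)\<bar> * (E t \<omega> / E s \<omega>) \<le> L t * \<Psi> \<omega>"
      by linarith
    also have "L t * \<Psi> \<omega> \<le> norm (L t * \<Psi> \<omega>)"
      by simp
    finally show ?case
      using E_pos[of t \<omega>] E_pos[of s \<omega>] by (simp add: abs_mult)
  qed
qed

text \<open>
  The needle variations have responses bounded by \<open>S\<^sup>2\<close> uniformly in their width, so the majorant of the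
  first variation also permits the passage to the limit.  For \<open>t\<^sub>0 = T\<close> the limit is \<open>0\<close> throughout.
\<close>

theorem adjoint_vanishes:
  assumes t\<^sub>0: "t\<^sub>0 \<in> {0..T}"
  defines "h \<equiv> \<lambda>t. \<integral>\<omega>. F\<^sub>1 t (X t \<omega>) * (E t \<omega> / E t\<^sub>0 \<omega>) \<partial>M"
  shows "integrable time (\<lambda>t. if t\<^sub>0 < t then h t else 0)"
    and "(\<integral>t. (if t\<^sub>0 < t then h t else 0) \<partial>time) = 0"
proof -
  define V where "V n = response (\<lambda>s _. needle t\<^sub>0 n s)" for n
  define H where "H q = F\<^sub>1 (fst q) (X (fst q) (snd q)) *
      (if t\<^sub>0 < fst q then E (fst q) (snd q) / E t\<^sub>0 (snd q) else 0)" for q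
  have n1: "(\<integral>s. \<bar>needle t\<^sub>0 n s\<bar> \<partial>time) \<le> 1" for n
    using needle_integral(1)[of t\<^sub>0 n] by (simp add: abs_of_nonneg[OF needle_nonneg])
  have F\<^sub>1X: "(\<lambda>q. F\<^sub>1 (fst q) (X (fst q) (snd q))) \<in> borel_measurable (time \<Otimes>\<^sub>M M)"
    using superposition_measurable[OF F\<^sub>1_measurable X_measurable] by (simp add: split_beta')
  have s_meas: "(\<lambda>q. F\<^sub>1 (fst q) (X (fst q) (snd q)) * V n (fst q) (snd q)) \<in> borel_measurable (time \<Otimes>\<^sub>M M)" for n
    using deterministic_response_measurable[OF needle_integrable, of t\<^sub>0 n]
    by (intro borel_measurable_times F\<^sub>1X) (simp add: V_def split_beta')
  have lim: "(\<lambda>n. F\<^sub>1 (fst q) (X (fst q) (snd q)) * V n (fst q) (snd q)) \<longlonglongrightarrow> H q"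
    if "q \<in> space (time \<Otimes>\<^sub>M M)" for q
    unfolding H_def V_def using that t\<^sub>0
    by (intro tendsto_mult tendsto_const response_needle_tendsto) (auto simp: space_pair_measure)
  have H_meas: "H \<in> borel_measurable (time \<Otimes>\<^sub>M M)"
    by (rule borel_measurable_LIMSEQ_real[OF lim s_meas])
  have dom: "AE q in time \<Otimes>\<^sub>M M. norm (F\<^sub>1 (fst q) (X (fst q) (snd q)) * V n (fst q) (snd q))
      \<le> L (fst q) * \<Psi> (snd q)" for n
  proof -
    have "AE \<omega> in M. \<forall>t\<in>{0..T}. \<bar>F\<^sub>1 t (X t \<omega>) * V n t \<omega>\<bar> \<le> L t * \<Psi> \<omega>"
      using AE_state_bound AE_response_le_square[OF needle_integrable n1[of n]]
    proof eventually_elim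
      case (elim \<omega>)
      show ?case
      proof
        fix t assume t: "t \<in> {0..T}"
        have V: "\<bar>V n t \<omega>\<bar> \<le> (S \<omega>)\<^sup>2" and X: "\<bar>X t \<omega>\<bar> \<le> (S \<omega>)\<^sup>2 * \<zeta> \<omega> - (S \<omega>)\<^sup>2"
          using elim t by (auto simp: V_def right_diff_distrib)
        from X have "\<bar>X t \<omega>\<bar> \<le> (S \<omega>)\<^sup>2 * \<zeta> \<omega>"
          using zero_le_power2[of "S \<omega>"] by linarith
        note b = growth_bound[OF t this]
        have "\<bar>F\<^sub>1 t (X t \<omega>) * V n t \<omega>\<bar> \<le> (\<bar>F t (X t \<omega>)\<bar> + \<bar>F\<^sub>1 t (X t \<omega>)\<bar>) * (S \<omega>)\<^sup>2"
          unfolding abs_mult using V by (intro mult_mono) auto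
        with b show "\<bar>F\<^sub>1 t (X t \<omega>) * V n t \<omega>\<bar> \<le> L t * \<Psi> \<omega>" by linarith
      qed
    qed
    from P.AE_snd_imp_AE_pair[OF this] AE_space show ?thesis
      by eventually_elim (auto simp: space_pair_measure)
  qed
  have lim_AE: "AE q in time \<Otimes>\<^sub>M M. (\<lambda>n. F\<^sub>1 (fst q) (X (fst q) (snd q)) * V n (fst q) (snd q)) \<longlonglongrightarrow> H q"
    using lim by simp
  have H_int: "integrable (time \<Otimes>\<^sub>M M) H"
    by (rule integrable_dominated_convergence[OF H_meas s_meas dominating_integrable lim_AE dom])
  have "(\<lambda>n. \<integral>q. F\<^sub>1 (fst q) (X (fst q) (snd q)) * V n (fst q) (snd q) \<partial>(time \<Otimes>\<^sub>M M))
      \<longlonglongrightarrow> (\<integral>q. H q \<partial>(time \<Otimes>\<^sub>M M))"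
    by (rule integral_dominated_convergence[OF H_meas s_meas dominating_integrable lim_AE dom])
  moreover have "(\<integral>q. F\<^sub>1 (fst q) (X (fst q) (snd q)) * V n (fst q) (snd q) \<partial>(time \<Otimes>\<^sub>M M)) = 0" for n
    unfolding V_def by (rule first_variation[OF needle_integrable n1])
  ultimately have "(\<integral>q. H q \<partial>(time \<Otimes>\<^sub>M M)) = 0"
    by (simp add: LIMSEQ_const_iff)
  moreover have "(\<integral>\<omega>. H (t, \<omega>) \<partial>M) = (if t\<^sub>0 < t then h t else 0)" for t
    by (simp add: H_def h_def)
  ultimately show "integrable time (\<lambda>t. if t\<^sub>0 < t then h t else 0)"
    and "(\<integral>t. (if t\<^sub>0 < t then h t else 0) \<partial>time) = 0"
    using P.integrable_fst'[OF H_int] P.integral_fst'[OF H_int] by simp_all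
qed

end

section \<open>The geometric Brownian flow\<close>

lemma nn_set_integral_time:
  "(\<integral>\<^sup>+t\<in>{0..T}. f t \<partial>lebesgue) = (\<integral>\<^sup>+t. f t \<partial>lebesgue_on {0..T::real})"
  by (subst nn_integral_restrict_space) simp_all

lemma set_integral_add_left_endpoint:
  fixes h :: "real \<Rightarrow> real"
  assumes int: "integrable (lebesgue_on {0..T}) (\<lambda>t. if a < t then h t else 0)" and a: "0 \<le> a" "a \<le> T"
  shows "set_integrable lebesgue {a..T} h"
    and "(LINT t:{a..T}|lebesgue. h t) = (\<integral>t. (if a < t then h t else 0) \<partial>lebesgue_on {0..T})"
proof -
  have split: "indicator {a..T} t *\<^sub>R h t
      = indicator {0..T} t *\<^sub>R (if a < t then h t else 0) + indicator {a} t * h a" for t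
    using a by (auto split: split_indicator)
  have i: "integrable lebesgue (\<lambda>t. indicator {0..T} t *\<^sub>R (if a < t then h t else 0))"
    using int by (simp add: integrable_restrict_space)
  have j: "integrable lebesgue (\<lambda>t. indicator {a} t * h a)"
    by (rule integrable_mult_left) simp
  show "set_integrable lebesgue {a..T} h"
    unfolding set_integrable_def split by (rule Bochner_Integration.integrable_add[OF i j])
  have "(\<integral>t. indicator {a} t * h a \<partial>lebesgue) = 0"
    by simp
  then show "(LINT t:{a..T}|lebesgue. h t) = (\<integral>t. (if a < t then h t else 0) \<partial>lebesgue_on {0..T})"
    unfolding set_lebesgue_integral_def split Bochner_Integration.integral_add[OF i j]
    by (simp add: integral_restrict_space)
qed

lemma primitive_continuous:
  assumes meas: "set_borel_measurable lebesgue {0..T} a"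
    and bounded: "AE t in lebesgue. t \<in> {0..T} \<longrightarrow> \<bar>a t\<bar> \<le> C"
  shows "continuous_on {0..T} (primitive a)"
proof -
  have "set_integrable lebesgue {0..T} a"
    unfolding set_integrable_def
  proof (rule Bochner_Integration.integrable_bound)
    show "integrable lebesgue (\<lambda>t. indicator {0..T} t * C)"
      by (intro integrable_mult_left integrable_real_indicator) (simp_all add: emeasure_lborel_Icc_eq)
    show "(\<lambda>t. indicator {0..T} t *\<^sub>R a t) \<in> borel_measurable lebesgue"
      using meas by (simp add: set_borel_measurable_def)
    show "AE t in lebesgue. norm (indicator {0..T} t *\<^sub>R a t) \<le> norm (indicator {0..T} t * C)"
      using bounded by eventually_elim (auto split: split_indicator intro: order_trans[OF _ abs_ge_self])
  qed
  then have a: "a absolutely_integrable_on {0..T}" .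
  have "continuous_on {0..T} (\<lambda>t. integral {0..t} a)"
    by (rule indefinite_integral_continuous_1[OF set_lebesgue_integral_eq_integral(1)[OF a]])
  moreover have "primitive a t = integral {0..t} a" if "t \<in> {0..T}" for t
  proof -
    have "{0..t} \<subseteq> {0..T}" using that by auto
    from set_lebesgue_integral_eq_integral(2)[OF absolutely_integrable_on_subinterval[OF a this]]
    show ?thesis unfolding primitive_def .
  qed
  ultimately show ?thesis
    using continuous_on_cong[OF refl, of "{0..T}" "primitive a" "\<lambda>t. integral {0..t} a"] by blast
qed

text \<open>
  \<open>S\<close> is a constant times the \<open>e\<close>-th root of an integrable bound for \<open>exp (e \<bar>W\<bar>)\<close> on \<open>[0, T]\<close>, so that
  integrability of \<open>S powr e\<close> is just that of the bound.
\<close>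

lemma (in brownian) flow_bound_exists:
  assumes T: "0 < T" and A: "\<And>t. t \<in> {0..T} \<Longrightarrow> \<bar>A t\<bar> \<le> K" and e: "0 < e"
  obtains S where "S \<in> borel_measurable M" "\<And>\<omega>. 1 \<le> S \<omega>" "integrable M (\<lambda>\<omega>. S \<omega> powr e)"
    "AE \<omega> in M. \<forall>t\<in>{0..T}. geom_bm W t \<omega> * exp (A t) \<le> S \<omega> \<and> 1 / (geom_bm W t \<omega> * exp (A t)) \<le> S \<omega>"
proof -
  obtain Q where Q: "integrable M Q" "AE \<omega> in M. \<forall>t\<in>{0..T}. exp (e * \<bar>W t \<omega>\<bar>) \<le> Q \<omega>"
    using exp_abs_sup_integrable[OF T e] by blast
  define c where "c = exp (T / 2 + K)"
  have K: "0 \<le> K" using A[of 0] T by auto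
  have c: "1 \<le> c" using T K by (simp add: c_def)
  define S where "S \<omega> = c * (1 + \<bar>Q \<omega>\<bar>) powr (1 / e)" for \<omega>
  have Q_meas[measurable]: "Q \<in> borel_measurable M" using Q by simp
  show thesis
  proof (rule that[of S])
    show "S \<in> borel_measurable M" unfolding S_def by measurable
    show "1 \<le> S \<omega>" for \<omega>
    proof -
      have "1 \<le> (1 + \<bar>Q \<omega>\<bar>) powr (1 / e)"
        using e by (intro ge_one_powr_ge_zero) auto
      from mult_mono[OF c this] show ?thesis using c by (simp add: S_def)
    qed
    have "S \<omega> powr e = c powr e * (1 + \<bar>Q \<omega>\<bar>)" for \<omega>
      using c e by (simp add: S_def powr_mult powr_powr)
    then show "integrable M (\<lambda>\<omega>. S \<omega> powr e)"
      using Q(1) by simp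
    show "AE \<omega> in M. \<forall>t\<in>{0..T}. geom_bm W t \<omega> * exp (A t) \<le> S \<omega> \<and> 1 / (geom_bm W t \<omega> * exp (A t)) \<le> S \<omega>"
      using Q(2)
    proof eventually_elim
      case (elim \<omega>)
      show ?case
      proof
        fix t assume t: "t \<in> {0..T}"
        have le: "W t \<omega> \<le> \<bar>W t \<omega>\<bar>" "- W t \<omega> \<le> \<bar>W t \<omega>\<bar>" "A t \<le> K" "- A t \<le> K" "0 \<le> t" "t \<le> T"
          using t A[OF t] by auto
        have "exp \<bar>W t \<omega>\<bar> = exp (e * \<bar>W t \<omega>\<bar>) powr (1 / e)"
          using e by (simp add: powr_def)
        also have "\<dots> \<le> (1 + \<bar>Q \<omega>\<bar>) powr (1 / e)"
          using bspec[OF elim t] e by (intro powr_mono2) auto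
        finally have "c * exp \<bar>W t \<omega>\<bar> \<le> S \<omega>"
          unfolding S_def using c by (intro mult_left_mono) auto
        moreover have "geom_bm W t \<omega> * exp (A t) \<le> c * exp \<bar>W t \<omega>\<bar>"
          unfolding geom_bm_def c_def exp_add[symmetric] exp_le_cancel_iff using le T by linarith
        moreover have "1 / (geom_bm W t \<omega> * exp (A t)) = exp (- (W t \<omega> - t / 2 + A t))"
          unfolding geom_bm_def exp_add[symmetric] exp_minus inverse_eq_divide by (rule refl)
        moreover have "exp (- (W t \<omega> - t / 2 + A t)) \<le> c * exp \<bar>W t \<omega>\<bar>"
          unfolding c_def exp_add[symmetric] exp_le_cancel_iff using le T by linarith
        ultimately show "geom_bm W t \<omega> * exp (A t) \<le> S \<omega> \<and> 1 / (geom_bm W t \<omega> * exp (A t)) \<le> S \<omega>"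
          by linarith
      qed
    qed
  qed
qed

lemma (in random_flow) state_eq_response:
  assumes E: "E = (\<lambda>t \<omega>. geom_bm W t \<omega> * exp (primitive a t))" and t: "t \<in> {0..T}"
  shows "state W a z u t \<omega> = response (\<lambda>s \<omega>. z s \<omega> - u s) t \<omega>"
proof -
  have Es: "E s \<omega> = geom_bm W s \<omega> * exp (primitive a s)" for s \<omega>
    by (simp add: E)
  have "indicator {0..t} s *\<^sub>R (exp (- primitive a s) / geom_bm W s \<omega> * (z s \<omega> - u s))
      = indicator {0..T} s *\<^sub>R (if s \<le> t then (z s \<omega> - u s) / E s \<omega> else 0)" for s
    using t by (auto simp: Es exp_minus divide_inverse mult_ac split: split_indicator)
  then have "(LINT s:{0..t}|lebesgue. exp (- primitive a s) / geom_bm W s \<omega> * (z s \<omega> - u s))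
      = (\<integral>s. (if s \<le> t then (z s \<omega> - u s) / E s \<omega> else 0) \<partial>time)"
    unfolding set_lebesgue_integral_def by (simp add: integral_restrict_space)
  then show ?thesis
    unfolding state_def response_def by (simp only: Es)
qed

theorem theorem3p2:
  fixes M :: "'a measure" and Fl :: "real \<Rightarrow> 'a measure"
    and W z :: "real \<Rightarrow> 'a \<Rightarrow> real"
    and a u_bar L :: "real \<Rightarrow> real"
    and F F\<^sub>1 F\<^sub>2 :: "real \<Rightarrow> real \<Rightarrow> real"
    and T p \<alpha> :: real
  assumes "T > 0"
    and "filtered_prob_space M Fl"
    and "brownian_motion M Fl W"
    and "set_borel_measurable lebesgue {0..T} a"
    and "\<exists>C. AE t in lebesgue. t \<in> {0..T} \<longrightarrow> \<bar>a t\<bar> \<le> C"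
    and "\<forall>t\<in>{0..T}. z t \<in> borel_measurable (Fl t)"
    and "(\<lambda>(t, \<omega>). z t \<omega>) \<in> borel_measurable (restrict_space borel {0..T} \<Otimes>\<^sub>M M)"
    and "p \<ge> 2"
    and "\<forall>t\<in>{0..T}. integrable M (\<lambda>\<omega>. \<bar>z t \<omega>\<bar> powr p)"
    and "(\<lambda>t. (LINT \<omega>|M. \<bar>z t \<omega>\<bar> powr p) powr (2 / p)) absolutely_integrable_on {0..T}"
    and "(\<lambda>(t, x). F t x) \<in> borel_measurable (restrict_space borel ({0..T} \<times> UNIV))"
    and "\<forall>t\<in>{0..T}. \<forall>x. F t x \<ge> 0"
    and "\<forall>t\<in>{0..T}. \<forall>x. (F t has_real_derivative F\<^sub>1 t x) (at x)"
    and "\<forall>t\<in>{0..T}. \<forall>x. (F\<^sub>1 t has_real_derivative F\<^sub>2 t x) (at x)"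
    and "continuous_on ({0..T} \<times> UNIV) (\<lambda>(t, x). F\<^sub>1 t x)"
    and "continuous_on ({0..T} \<times> UNIV) (\<lambda>(t, x). F\<^sub>2 t x)"
    and "0 < \<alpha>" and "\<alpha> < p"
    and "L absolutely_integrable_on {0..T}"
    and "\<forall>t\<in>{0..T}. L t \<ge> 0"
    and "\<forall>t\<in>{0..T}. \<forall>x. \<bar>F t x\<bar> + \<bar>F\<^sub>1 t x\<bar> + \<bar>F\<^sub>2 t x\<bar> \<le> L t * (1 + \<bar>x\<bar> powr \<alpha>)"
    and "u_bar absolutely_integrable_on {0..T}"
    and "\<forall>u. u absolutely_integrable_on {0..T} \<longrightarrow>
           cost M W a z F T u_bar \<le> cost M W a z F T u"
  shows "\<forall>t\<^sub>0\<in>{0..T}.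
    (\<forall>t\<in>{t\<^sub>0..T}. integrable M (\<lambda>\<omega>. F\<^sub>1 t (state W a z u_bar t \<omega>) *
       (geom_bm W t \<omega> / geom_bm W t\<^sub>0 \<omega>) * exp (primitive a t - primitive a t\<^sub>0))) \<and>
    (\<lambda>t. LINT \<omega>|M. F\<^sub>1 t (state W a z u_bar t \<omega>) *
       (geom_bm W t \<omega> / geom_bm W t\<^sub>0 \<omega>) * exp (primitive a t - primitive a t\<^sub>0))
       absolutely_integrable_on {t\<^sub>0..T} \<and>
    (LINT t:{t\<^sub>0..T}|lebesgue. LINT \<omega>|M. F\<^sub>1 t (state W a z u_bar t \<omega>) *
       (geom_bm W t \<omega> / geom_bm W t\<^sub>0 \<omega>) * exp (primitive a t - primitive a t\<^sub>0)) = 0"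
proof -
  have aux: "\<bar>F t x\<bar> + \<bar>F\<^sub>1 t x\<bar> \<le> L t * (1 + \<bar>x\<bar> powr \<alpha>)" if "t \<in> {0..T}" for t x
    using bspec[OF assms(21) that, THEN spec, of x] abs_ge_zero[of "F\<^sub>2 t x"] by linarith
  interpret prob_space M
    using assms(2) by (simp add: filtered_prob_space_def)
  interpret brownian M Fl W
    by unfold_locales (fact assms(2), fact assms(3))
  let ?time = "lebesgue_on {0..T}"
  have time_ident: "(\<lambda>t. t) \<in> borel_measurable ?time"
    using id_borel_measurable_lebesgue_on[of "{0..T}"] by (simp add: id_def)
  obtain C where C: "AE t in lebesgue. t \<in> {0..T} \<longrightarrow> \<bar>a t\<bar> \<le> C"
    using assms(5) by blast
  have A_cont: "continuous_on {0..T} (primitive a)"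
    by (rule primitive_continuous[OF assms(4) C])
  have "bounded (primitive a ` {0..T})"
    using compact_imp_bounded[OF compact_continuous_image[OF A_cont]] by simp
  then obtain K where K: "\<And>t. t \<in> {0..T} \<Longrightarrow> \<bar>primitive a t\<bar> \<le> K"
    unfolding bounded_iff by (metis imageI real_norm_def)
  (* the moment of S that integrable_powr_mult_powr asks for with exponent 2 + 2 \<alpha> *)
  define e where "e = (2 + 2 * \<alpha>) * p / (p - \<alpha>)"
  have e: "0 < e" using assms(8,17,18) by (simp add: e_def)
  obtain S where S: "S \<in> borel_measurable M" "\<And>\<omega>. 1 \<le> S \<omega>" "integrable M (\<lambda>\<omega>. S \<omega> powr e)"
    "AE \<omega> in M. \<forall>t\<in>{0..T}. geom_bm W t \<omega> * exp (primitive a t) \<le> S \<omega> \<and>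
        1 / (geom_bm W t \<omega> * exp (primitive a t)) \<le> S \<omega>"
    using flow_bound_exists[where A = "primitive a", OF assms(1) K e] by blast
  define E where "E = (\<lambda>t \<omega>. geom_bm W t \<omega> * exp (primitive a t))"
  interpret random_flow M T E S
  proof
    have "primitive a \<in> borel_measurable ?time"
      by (rule continuous_imp_measurable_on_sets_lebesgue[OF A_cont]) simp
    then have "(\<lambda>q. primitive a (fst q)) \<in> borel_measurable (?time \<Otimes>\<^sub>M M)"
      by (rule measurable_compose[OF measurable_fst])
    moreover have "(\<lambda>q. fst q) \<in> borel_measurable (?time \<Otimes>\<^sub>M M)"
      by (rule measurable_compose[OF measurable_fst time_ident])
    moreover have "(\<lambda>q. W (fst q) (snd q)) \<in> borel_measurable (?time \<Otimes>\<^sub>M M)"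
      using W_jointly_measurable[of T] by (simp add: split_beta')
    ultimately show "case_prod E \<in> borel_measurable (?time \<Otimes>\<^sub>M M)"
      unfolding E_def geom_bm_def split_beta'
      by (intro borel_measurable_times borel_measurable_exp borel_measurable_diff borel_measurable_divide) simp_all
    fix \<omega> assume "\<omega> \<in> space M"
    from continuous_on_subset[OF W_continuous[OF this], of "{0..T}"]
    show "continuous_on {0..T} (\<lambda>t. E t \<omega>)"
      unfolding E_def geom_bm_def by (intro continuous_intros A_cont) auto
  next
    show "AE \<omega> in M. \<forall>t\<in>{0..T}. E t \<omega> \<le> S \<omega> \<and> 1 / E t \<omega> \<le> S \<omega>"
      using S(4) by (simp add: E_def)
  qed (use assms(1) S in \<open>auto simp: E_def geom_bm_def\<close>)

  have z_meas: "case_prod z \<in> borel_measurable (?time \<Otimes>\<^sub>M M)"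
  proof -
    have "(\<lambda>t. t) \<in> measurable ?time (restrict_space borel {0..T})"
      using time_ident by (intro measurable_restrict_space2) auto
    then have "(\<lambda>q. (fst q, snd q)) \<in> measurable (?time \<Otimes>\<^sub>M M) (restrict_space borel {0..T} \<Otimes>\<^sub>M M)"
      by (intro measurable_Pair measurable_snd) (rule measurable_compose[OF measurable_fst])
    from measurable_compose[OF this assms(7)] show ?thesis
      by (simp add: split_beta')
  qed
  (* at least the L^p norm of z t, since x \<le> 1 + x^2, and integrable by assumption *)
  define n where "n t = 1 + (LINT \<omega>|M. \<bar>z t \<omega>\<bar> powr p) powr (2 / p)" for t
  have n_int: "integrable ?time n"
  proof -
    have "integrable ?time (\<lambda>t. (LINT \<omega>|M. \<bar>z t \<omega>\<bar> powr p) powr (2 / p))"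
      using assms(10) by (simp add: integrable_restrict_space set_integrable_def)
    then show ?thesis
      unfolding n_def by (intro Bochner_Integration.integrable_add) simp_all
  qed
  have n_moment: "(\<integral>\<^sup>+\<omega>. ennreal (\<bar>z t \<omega>\<bar> powr p) \<partial>M) \<le> ennreal (n t powr p)" if "t \<in> {0..T}" for t
  proof -
    define m where "m = (LINT \<omega>|M. \<bar>z t \<omega>\<bar> powr p)"
    have m: "0 \<le> m" by (simp add: m_def)
    have n: "1 \<le> n t" by (simp add: n_def)
    have "m = (m powr (2 / p)) powr (p / 2)"
      using m assms(8) by (simp add: powr_powr)
    also have "\<dots> \<le> n t powr (p / 2)"
      using assms(8) by (intro powr_mono2) (simp_all add: n_def m_def)
    also have "\<dots> \<le> n t powr p"
      using n assms(8) by (intro powr_mono) auto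
    finally have "ennreal m \<le> ennreal (n t powr p)"
      by (rule ennreal_leI)
    moreover have "(\<integral>\<^sup>+\<omega>. ennreal (\<bar>z t \<omega>\<bar> powr p) \<partial>M) = ennreal m"
      unfolding m_def using assms(9) that by (intro nn_integral_eq_integral) auto
    ultimately show ?thesis by simp
  qed
  have p1: "1 < p" using assms(8) by simp
  have n_pos: "0 < n t" for t by (simp add: n_def add_pos_nonneg)
  note z_moments = P.integral_moment_finite[OF z_meas p1 n_int n_pos n_moment[unfolded atLeastAtMost_iff]]
  have Z_int: "integrable M (\<lambda>\<omega>. (\<integral>s. \<bar>z s \<omega>\<bar> \<partial>?time) powr p)"
    and z_int: "AE \<omega> in M. integrable ?time (\<lambda>s. z s \<omega>)"
    using z_moments by (simp_all add: n_moment)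
  have Z_meas: "(\<lambda>\<omega>. \<integral>s. \<bar>z s \<omega>\<bar> \<partial>?time) \<in> borel_measurable M"
    using z_meas by measurable
  have cost_eq: "cost M W a z F T v =
      (\<integral>\<^sup>+\<omega>. (\<integral>\<^sup>+t. ennreal (F t (response (\<lambda>s \<omega>. z s \<omega> - v s) t \<omega>)) \<partial>?time) \<partial>M)" for v
    unfolding cost_def nn_set_integral_time
    by (intro nn_integral_cong) (simp add: state_eq_response[OF E_def])
  interpret control_problem M T E S z u_bar L F F\<^sub>1 \<alpha>
  proof
    show "case_prod z \<in> borel_measurable (?time \<Otimes>\<^sub>M M)" by (rule z_meas)
    show "AE \<omega> in M. integrable ?time (\<lambda>s. z s \<omega>)" by (rule z_int)
    show "integrable ?time u_bar" "integrable ?time L"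
      using assms(19,22) by (simp_all add: integrable_restrict_space set_integrable_def)
    show "0 < \<alpha>" by fact
    show "(\<lambda>(t, x). F t x) \<in> borel_measurable (restrict_space borel ({0..T} \<times> UNIV))" by fact
    show "continuous_on ({0..T} \<times> UNIV) (\<lambda>(t, x). F\<^sub>1 t x)" by fact
    show "integrable M (\<lambda>\<omega>. S \<omega> powr (2 + 2 * \<alpha>) * (c + (\<integral>s. \<bar>z s \<omega>\<bar> \<partial>?time)) powr \<alpha>)" if "0 \<le> c" for c
      using S(3) assms(17,18) that unfolding e_def
      by (intro integrable_powr_mult_powr[OF S(1) Z_meas _ S(2) _ _ _ _ _ Z_int])
        (auto intro: finite_measure_axioms)
    fix v :: "real \<Rightarrow> real" assume "integrable ?time v"
    then have "v absolutely_integrable_on {0..T}"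
      by (simp add: integrable_restrict_space set_integrable_def)
    with assms(23) show "(\<integral>\<^sup>+\<omega>. (\<integral>\<^sup>+t. ennreal (F t (response (\<lambda>s \<omega>. z s \<omega> - u_bar s) t \<omega>)) \<partial>?time) \<partial>M)
        \<le> (\<integral>\<^sup>+\<omega>. (\<integral>\<^sup>+t. ennreal (F t (response (\<lambda>s \<omega>. z s \<omega> - v s) t \<omega>)) \<partial>?time) \<partial>M)"
      unfolding cost_eq by blast
  qed (use assms(12,13,20) aux in auto)
  have integrand: "F\<^sub>1 t (state W a z u_bar t \<omega>) * (geom_bm W t \<omega> / geom_bm W t\<^sub>0 \<omega>)
      * exp (primitive a t - primitive a t\<^sub>0) = F\<^sub>1 t (X t \<omega>) * (E t \<omega> / E t\<^sub>0 \<omega>)"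
    if "t \<in> {0..T}" for t t\<^sub>0 \<omega>
    unfolding state_eq_response[OF E_def that] X_def by (simp add: E_def exp_diff)
  show ?thesis
  proof (intro ballI conjI)
    fix t\<^sub>0 assume t\<^sub>0: "t\<^sub>0 \<in> {0..T}"
    show "integrable M (\<lambda>\<omega>. F\<^sub>1 t (state W a z u_bar t \<omega>) *
       (geom_bm W t \<omega> / geom_bm W t\<^sub>0 \<omega>) * exp (primitive a t - primitive a t\<^sub>0))"
      if "t \<in> {t\<^sub>0..T}" for t
    proof -
      have "t \<in> {0..T}" using that t\<^sub>0 by auto
      then show ?thesis unfolding integrand[OF \<open>t \<in> {0..T}\<close>] by (rule adjoint_integrable[OF _ t\<^sub>0])
    qed
    let ?h = "\<lambda>t. LINT \<omega>|M. F\<^sub>1 t (state W a z u_bar t \<omega>) *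
       (geom_bm W t \<omega> / geom_bm W t\<^sub>0 \<omega>) * exp (primitive a t - primitive a t\<^sub>0)"
    have eq: "(if t\<^sub>0 < t then \<integral>\<omega>. F\<^sub>1 t (X t \<omega>) * (E t \<omega> / E t\<^sub>0 \<omega>) \<partial>M else 0)
        = (if t\<^sub>0 < t then ?h t else 0)" if "t \<in> space ?time" for t
    proof -
      have "t \<in> {0..T}" using that by simp
      then show ?thesis by (simp only: integrand)
    qed
    have h: "integrable ?time (\<lambda>t. if t\<^sub>0 < t then ?h t else 0)"
      by (rule Bochner_Integration.integrable_cong[THEN iffD1, OF refl _ adjoint_vanishes(1)[OF t\<^sub>0]]) (rule eq)
    have h0: "(\<integral>t. (if t\<^sub>0 < t then ?h t else 0) \<partial>?time) = 0"
      by (rule trans[OF Bochner_Integration.integral_cong[OF refl, symmetric] adjoint_vanishes(2)[OF t\<^sub>0]]) (rule eq)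
    have bd: "0 \<le> t\<^sub>0" "t\<^sub>0 \<le> T" using t\<^sub>0 by auto
    show "?h absolutely_integrable_on {t\<^sub>0..T}"
      by (rule set_integral_add_left_endpoint(1)[OF h bd])
    show "(LINT t:{t\<^sub>0..T}|lebesgue. ?h t) = 0"
      using set_integral_add_left_endpoint(2)[OF h bd] h0 by simp
  qed
qed

end
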